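(* Let $|q|<1$ and let $k\geq 5$ be an integer. Then \[ \sum_{m_1,\dots,m_{k-2}\geq 0} \frac{q^{(m_1+m_2)^2+m_2^2+\cdots+m_{k-3}^2+m_{k-3}m_{k-2}}}{(q)_{m_1}(q)_{2m_2}} \Bigl(\prod_{j=3}^{k-3}\begin{bmatrix}m_{j-1}+m_j-m_{j+1}\\ 2m_j\end{bmatrix}\Bigr) \begin{bmatrix}m_{k-3}\\ m_{k-2}\end{bmatrix} =\frac{(q^{F_kF_{k-2}-1},q^{F_kF_{k-2}},q^{2F_kF_{k-2}-1};q^{2F_kF_{k-2}-1})_{\infty}}{(q;q)_{\infty}}. \]
   Context: $F_k$ denotes the Fibonacci numbers: $F_0=0$, $F_1=1$, $F_k=F_{k-1}+F_{k-2}$. $(x;q)_n=\prod_{i=0}^{n-1}(1-xq^i)$ (with $n=\infty$ allowed), $(q)_n=(q;q)_n$, and $(x_1,\dots,x_r;q)_\infty=\prod_{i=1}^r(x_i;q)_\infty$. The $q$-binomial coefficient is $\begin{bmatrix}n\\ m\end{bmatrix}=\frac{(q)_n}{(q)_m(q)_{n-m}}$ if $m$ and $n-m$ are nonnegative integers and $0$ otherwise. An empty product equals $1$. *)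

theory Defs
  imports "HOL-Analysis.Analysis" "HOL-Number_Theory.Fib"
begin

definition qpoch :: "complex \<Rightarrow> complex \<Rightarrow> nat \<Rightarrow> complex" where
  "qpoch a q n = (\<Prod>i<n. 1 - a * q ^ i)"

definition qpoch_inf :: "complex \<Rightarrow> complex \<Rightarrow> complex" where
  "qpoch_inf a q = (\<Prod>i. 1 - a * q ^ i)"

definition qbinom :: "complex \<Rightarrow> int \<Rightarrow> int \<Rightarrow> complex" where
  "qbinom q n m = (if 0 \<le> m \<and> m \<le> n
     then qpoch q q (nat n) / (qpoch q q (nat m) * qpoch q q (nat (n - m))) else 0)"

end

theory Submission
  imports Defs
begin

text \<open>
  The engine of the proof is the Burge transform, a consequence of the \<open>q\<close>-Saalschuetz sum. It
  sends the product \<open>B(L, M, a, b) = [L+M+a-b; L+a] [L+M-a+b; L-a]\<close> of two Gaussian binomials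
  to \<open>q^(b^2) B(L, M, a+b, b)\<close>, and \<open>B(L, M, a, b) = B(M, L, b, a)\<close>, so alternating the
  transform with this symmetry turns \<open>(a, b) = (n, n)\<close> into \<open>(F_(t+2) n, F_(t+1) n)\<close>.
  Each sum over some \<open>m_j\<close> with \<open>j \<ge> 4\<close> is one such step. It starts from
  \<open>q^(LM) [L+M; L] = \<Sum>n. (-1)^n q^(n(n-1)/2) B(L, M, n, n)\<close> with \<open>L = m_(k-2)\<close> and
  \<open>L + M = m_(k-3)\<close>, whose left-hand side times \<open>q^(L^2)\<close> is \<open>q^(m_(k-3) m_(k-2)) [m_(k-3); m_(k-2)]\<close>.
  The sum over \<open>m_3\<close> is the limit \<open>M \<rightarrow> \<infinity>\<close> of the transform, and the sums over \<open>m_2\<close>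
  and \<open>m_1 + m_2\<close> are two applications of the Bailey lemma, each adding \<open>(F_(k-2) n)^2\<close> to
  the exponent. The sum of the squares of Fibonacci numbers collected on the way is
  \<open>F_k F_(k-2) - 1\<close>, and the remaining theta series is summed by the Jacobi triple product.
\<close>

section \<open>Gaussian binomials and the \<open>q\<close>-Saalschuetz sum\<close>

lemma qpoch_0 [simp]: "qpoch a q 0 = 1"
  by (simp add: qpoch_def)

lemma qpoch_Suc: "qpoch a q (Suc n) = qpoch a q n * (1 - a * q ^ n)"
  by (simp add: qpoch_def)

definition gbin :: "complex \<Rightarrow> nat \<Rightarrow> nat \<Rightarrow> complex" where
  "gbin q n k = (if k \<le> n then qpoch q q n / (qpoch q q k * qpoch q q (n - k)) else 0)"

lemma qbinom_eq_gbin: "0 \<le> a \<Longrightarrow> 0 \<le> b \<Longrightarrow> qbinom q a b = gbin q (nat a) (nat b)"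
  by (auto simp: qbinom_def gbin_def nat_diff_distrib le_nat_iff nat_le_eq_zle)

lemma qbinom_of_nat [simp]: "qbinom q (int n) (int k) = gbin q n k"
  by (simp add: qbinom_eq_gbin)

lemma qbinom_eq_0: "b < 0 \<or> a < b \<Longrightarrow> qbinom q a b = 0"
  by (auto simp: qbinom_def)

lemma qbinom_symm: "qbinom q n m = qbinom q n (n - m)"
  by (auto simp: qbinom_def)

lemma gbin_eq_0 [simp]: "n < k \<Longrightarrow> gbin q n k = 0"
  by (simp add: gbin_def)

lemma gbin_symm: "k \<le> n \<Longrightarrow> gbin q n (n - k) = gbin q n k"
  by (simp add: gbin_def)

context
  fixes q :: complex
  assumes norm_q: "norm q < 1"
begin

lemma one_minus_q_power_nz: "0 < n \<Longrightarrow> 1 - q ^ n \<noteq> 0"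
proof
  assume "0 < n" "1 - q ^ n = 0"
  then have "norm q ^ n = 1"
    by (metis norm_one norm_power right_minus_eq)
  moreover have "norm q ^ n < 1"
    using norm_q \<open>0 < n\<close> by (simp add: power_less_one_iff)
  ultimately show False by simp
qed

lemma qfac_nz [simp]: "qpoch q q n \<noteq> 0"
proof (induction n)
  case (Suc n)
  then show ?case
    using one_minus_q_power_nz[of "Suc n"] by (simp add: qpoch_Suc)
qed simp

lemma gbin_0 [simp]: "gbin q n 0 = 1"
  by (simp add: gbin_def)

lemma gbin_self [simp]: "gbin q n n = 1"
  by (simp add: gbin_def)

lemma gbin_Suc_Suc: "gbin q (Suc n) (Suc k) = gbin q n k + q ^ Suc k * gbin q n (Suc k)"
proof (cases "k < n")
  case True
  then obtain d where n: "n = Suc (k + d)"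
    using less_imp_Suc_add by blast
  have nz: "1 - q ^ Suc k \<noteq> 0" "1 - q ^ Suc d \<noteq> 0" "qpoch q q k \<noteq> 0" "qpoch q q d \<noteq> 0"
    by (rule one_minus_q_power_nz qfac_nz; simp)+
  have "gbin q n k = qpoch q q n / (qpoch q q k * (qpoch q q d * (1 - q ^ Suc d)))"
    and "gbin q n (Suc k) = qpoch q q n / ((qpoch q q k * (1 - q ^ Suc k)) * qpoch q q d)"
    and "gbin q (Suc n) (Suc k) = qpoch q q n * (1 - q ^ Suc k * q ^ Suc d)
          / ((qpoch q q k * (1 - q ^ Suc k)) * (qpoch q q d * (1 - q ^ Suc d)))"
    unfolding n by (simp_all add: gbin_def qpoch_Suc Suc_diff_le power_add mult_ac)
  \<comment> \<open>With \<open>x = q ^ Suc k\<close> and \<open>y = q ^ Suc d\<close>, Pascal's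
    rule is \<open>1 - x * y = (1 - x) + x * (1 - y)\<close> over a common denominator.\<close>
  moreover have "F * (1 - x * y) / ((K * (1 - x)) * (D * (1 - y)))
      = F / (K * (D * (1 - y))) + x * (F / ((K * (1 - x)) * D))"
    if "1 - x \<noteq> 0" "1 - y \<noteq> 0" "K \<noteq> 0" "D \<noteq> 0" for F K D x y :: complex
    using that by (simp add: divide_simps) (simp add: algebra_simps)
  from this[OF nz, of "qpoch q q n"] calculation show ?thesis
    by (simp only:)
next
  case False
  then show ?thesis
    by (cases "k = n") auto
qed

lemma gbin_Suc_Suc':
  assumes "k \<le> n"
  shows "gbin q (Suc n) (Suc k) = q ^ (n - k) * gbin q n k + gbin q n (Suc k)"
proof (cases "k = n")
  case False
  with assms have k: "k < n" by simp
  have "gbin q (Suc n) (Suc k) = gbin q (Suc n) (Suc (n - Suc k))"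
    using k gbin_symm[of "Suc k" "Suc n" q] by (simp add: Suc_diff_Suc)
  also have "\<dots> = gbin q n (n - Suc k) + q ^ (n - k) * gbin q n (n - k)"
    using gbin_Suc_Suc[of n "n - Suc k"] k by (simp add: Suc_diff_Suc)
  finally show ?thesis
    using k by (simp add: gbin_symm)
qed simp

text \<open>Induction on \<open>m\<close> by Pascal's rule. The truncated exponent does no harm: if
  \<open>m + j < k\<close>, then \<open>gbin q m (k - j)\<close> is zero.\<close>

lemma q_vandermonde:
  "gbin q (m + n) k = (\<Sum>j\<le>k. q ^ (j * (m + j - k)) * gbin q m (k - j) * gbin q n j)"
proof (induction m arbitrary: k)
  case 0
  have "(\<Sum>j\<le>k. q ^ (j * (0 + j - k)) * gbin q 0 (k - j) * gbin q n j)
      = (\<Sum>j\<le>k. if j = k then gbin q n k else 0)"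
    by (intro sum.cong) auto
  then show ?case by simp
next
  case (Suc m)
  show ?case
  proof (cases k)
    case (Suc k')
    have "gbin q (Suc m + n) k = gbin q (m + n) k' + q ^ k * gbin q (m + n) k"
      by (simp add: Suc gbin_Suc_Suc del: power_Suc)
    also have "\<dots> = (\<Sum>j\<le>k'. q ^ (j * (m + j - k')) * gbin q m (k' - j) * gbin q n j)
        + q ^ k * (\<Sum>j\<le>k. q ^ (j * (m + j - k)) * gbin q m (k - j) * gbin q n j)"
      by (simp only: Suc.IH)
    also have "(\<Sum>j\<le>k'. q ^ (j * (m + j - k')) * gbin q m (k' - j) * gbin q n j)
        = (\<Sum>j\<le>k. if j = k then 0 else q ^ (j * (m + j - k')) * gbin q m (k' - j) * gbin q n j)"
      by (intro sum.mono_neutral_cong_left) (auto simp: Suc)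
    also have "\<dots> + q ^ k * (\<Sum>j\<le>k. q ^ (j * (m + j - k)) * gbin q m (k - j) * gbin q n j)
        = (\<Sum>j\<le>k. q ^ (j * (Suc m + j - k)) * gbin q (Suc m) (k - j) * gbin q n j)"
      unfolding sum_distrib_left sum.distrib[symmetric]
    proof (rule sum.cong[OF refl])
      fix j assume j: "j \<in> {..k}"
      show "(if j = k then 0 else q ^ (j * (m + j - k')) * gbin q m (k' - j) * gbin q n j)
          + q ^ k * (q ^ (j * (m + j - k)) * gbin q m (k - j) * gbin q n j)
          = q ^ (j * (Suc m + j - k)) * gbin q (Suc m) (k - j) * gbin q n j"
      proof (cases "j = k")
        case True
        then show ?thesis
          by (simp add: Suc algebra_simps flip: power_add)
      next
        case False
        with j Suc have jk: "j \<le> k'" by auto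
        have pascal: "gbin q (Suc m) (k - j) = gbin q m (k' - j) + q ^ (k - j) * gbin q m (k - j)"
          using gbin_Suc_Suc[of m "k' - j"] jk by (simp add: Suc Suc_diff_le)
        show ?thesis
        proof (cases "k - j \<le> m")
          case True
          obtain d where d: "m + j = k + d"
            using True by (metis le_add_diff_inverse le_diff_conv)
          then have "Suc m + j - k = Suc d" "m + j - k = d"
            by auto
          then have "j * (Suc m + j - k) + (k - j) = k + j * (m + j - k)"
            using jk Suc by simp
          then have "q ^ (j * (Suc m + j - k)) * q ^ (k - j) = q ^ k * q ^ (j * (m + j - k))"
            by (simp flip: power_add)
          moreover have "m + j - k' = Suc m + j - k"
            using Suc by simp
          ultimately show ?thesis
            using False by (simp add: pascal algebra_simps)
        qed (use False pascal Suc in simp)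
      qed
    qed
    finally show ?thesis .
  qed simp
qed

text \<open>Trinomial revision: both sides equal
  \<open>(q)_n / ((q)_j (q)_(k-j) (q)_(n-k))\<close>.\<close>

lemma gbin_revision:
  assumes "j \<le> k" "k \<le> n"
  shows "gbin q n k * gbin q k j = gbin q n (k - j) * gbin q (n - k + j) j"
proof -
  have "n - (k - j) = n - k + j" "k - j \<le> n"
    using assms by auto
  then show ?thesis
    using assms by (simp add: gbin_def field_simps)
qed

text \<open>
  The \<open>q\<close>-Vandermonde sum is used three times. Splitting the top of the first binomial as
  \<open>(l - s) + (a + b - l + m)\<close> gives a power of \<open>q\<close> that does not depend on \<open>s\<close>, after which
  both the sum over \<open>s\<close> and the remaining one are again \<open>q\<close>-Vandermonde sums.
\<close>

lemma q_saalschuetz: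
  assumes l: "l \<le> b"
  shows "(\<Sum>s\<le>l. q ^ (s * (s + (b - l))) * gbin q (a + b + m - s) (a + b) * gbin q a s * gbin q b (l - s))
       = gbin q (a + b - l + m) m * gbin q (b + m) l"
proof -
  define N where "N = a + b - l"
  define T where "T s r = q ^ ((m - r) * (l - r)) * gbin q (l - s) (r - s) * gbin q (N + m) (m - r)" for s r
  \<comment> \<open>Vandermonde expansion of the first binomial, its index \<open>j\<close> replaced
    by \<open>r = m - j\<close>. The factor \<open>gbin q a s\<close> is kept so that both sides
    vanish for \<open>s > a\<close>.\<close>
  have expand: "gbin q (a + b + m - s) (a + b) * gbin q a s
      = (\<Sum>r\<le>m. if s \<le> r \<and> r \<le> l then T s r else 0) * gbin q a s" if s: "s \<le> l" for s
  proof (cases "s \<le> m \<and> s \<le> a")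
    case True
    have "gbin q (a + b + m - s) (a + b) = gbin q ((l - s) + (N + m)) (m - s)"
      using gbin_symm[of "m - s" "a + b + m - s" q] True s l
      by (simp add: N_def add.assoc)
    also have "\<dots> = (\<Sum>j\<le>m - s. q ^ (j * (l - s + j - (m - s))) * gbin q (l - s) (m - s - j) * gbin q (N + m) j)"
      by (rule q_vandermonde)
    also have "\<dots> = (\<Sum>r\<in>{s..m}. q ^ ((m - r) * (l - s + (m - r) - (m - s))) * gbin q (l - s) (r - s) * gbin q (N + m) (m - r))"
      by (rule sum.reindex_bij_witness[of _ "\<lambda>r. m - r" "\<lambda>j. m - j"]) (use True in \<open>auto simp: add.commute[of s]\<close>)
    also have "\<dots> = (\<Sum>r\<le>m. if s \<le> r \<and> r \<le> l then T s r else 0)"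
    proof (rule sum.mono_neutral_cong_left)
      fix r assume r: "r \<in> {s..m}"
      show "q ^ ((m - r) * (l - s + (m - r) - (m - s))) * gbin q (l - s) (r - s) * gbin q (N + m) (m - r)
          = (if s \<le> r \<and> r \<le> l then T s r else 0)"
      proof (cases "r \<le> l")
        case True
        then have "l - s + (m - r) - (m - s) = l - r"
          using r s by auto
        then show ?thesis
          using True r by (simp add: T_def)
      next
        case False
        then show ?thesis
          using r s by simp
      qed
    qed auto
    finally show ?thesis by simp
  next
    case False
    show ?thesis
    proof (cases "s \<le> a")
      case True
      then have "m < s" using False by simp
      then have "gbin q (a + b + m - s) (a + b) = 0"
        using True by (intro gbin_eq_0) linarith
      moreover have "(\<Sum>r\<le>m. if s \<le> r \<and> r \<le> l then T s r else 0) = 0"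
        using \<open>m < s\<close> by (intro sum.neutral) auto
      ultimately show ?thesis by simp
    qed simp
  qed
  \<comment> \<open>For fixed \<open>r\<close>, trinomial revision moves the
    \<open>s\<close>-dependence of the last two binomials into
    \<open>gbin q (b - l + r) (r - s)\<close>. The sum over \<open>s\<close> is then a Vandermonde
    sum with tops \<open>b - l + r\<close> and \<open>a\<close>.\<close>
  have inner: "(\<Sum>s\<le>l. q ^ (s * (s + (b - l))) * gbin q a s * gbin q b (l - s) * (if s \<le> r \<and> r \<le> l then T s r else 0))
     = (if r \<le> l then gbin q (N + m) m * (q ^ ((l - r) * (m - r)) * gbin q m r * gbin q b (l - r)) else 0)"
    if r: "r \<le> m" for r
  proof (cases "r \<le> l")
    case True
    have "(\<Sum>s\<le>l. q ^ (s * (s + (b - l))) * gbin q a s * gbin q b (l - s) * (if s \<le> r \<and> r \<le> l then T s r else 0))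
       = (\<Sum>s\<le>r. q ^ (s * (s + (b - l))) * gbin q a s * gbin q b (l - s) * T s r)"
      using True by (intro sum.mono_neutral_cong_right) auto
    also have "\<dots> = (\<Sum>s\<le>r. (q ^ ((m - r) * (l - r)) * gbin q (N + m) (m - r) * gbin q b (l - r))
        * (q ^ (s * ((b - l + r) + s - r)) * gbin q (b - l + r) (r - s) * gbin q a s))"
    proof (rule sum.cong[OF refl])
      fix s assume s: "s \<in> {..r}"
      have rev: "gbin q b (l - s) * gbin q (l - s) (r - s) = gbin q b (l - r) * gbin q (b - l + r) (r - s)"
        using gbin_revision[of "r - s" "l - s" b] True s l by simp
      have e: "s + (b - l) = (b - l + r) + s - r" by simp
      have "q ^ (s * (s + (b - l))) * gbin q a s * gbin q b (l - s) * T s r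
          = q ^ (s * (s + (b - l))) * gbin q a s * q ^ ((m - r) * (l - r)) * gbin q (N + m) (m - r)
            * (gbin q b (l - s) * gbin q (l - s) (r - s))"
        by (simp only: T_def mult_ac)
      then show "q ^ (s * (s + (b - l))) * gbin q a s * gbin q b (l - s) * T s r
        = (q ^ ((m - r) * (l - r)) * gbin q (N + m) (m - r) * gbin q b (l - r))
        * (q ^ (s * ((b - l + r) + s - r)) * gbin q (b - l + r) (r - s) * gbin q a s)"
        unfolding rev e by (simp only: mult_ac)
    qed
    also have "\<dots> = (q ^ ((m - r) * (l - r)) * gbin q (N + m) (m - r) * gbin q b (l - r)) * gbin q (b - l + r + a) r"
      by (simp only: q_vandermonde sum_distrib_left)
    also have "b - l + r + a = N + m - m + r"
      using l by (simp add: N_def)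
    \<comment> \<open>A second revision splits off \<open>gbin q (N + m) m\<close>, which does not
      depend on \<open>r\<close>.\<close>
    also have "(q ^ ((m - r) * (l - r)) * gbin q (N + m) (m - r) * gbin q b (l - r)) * gbin q (N + m - m + r) r
        = q ^ ((m - r) * (l - r)) * gbin q b (l - r) * (gbin q (N + m) m * gbin q m r)"
      using gbin_revision[of r m "N + m"] r by (simp add: mult_ac)
    finally show ?thesis
      using True by (simp add: mult_ac)
  qed (auto intro!: sum.neutral)
  have "(\<Sum>s\<le>l. q ^ (s * (s + (b - l))) * gbin q (a + b + m - s) (a + b) * gbin q a s * gbin q b (l - s))
      = (\<Sum>s\<le>l. \<Sum>r\<le>m. q ^ (s * (s + (b - l))) * gbin q a s * gbin q b (l - s) * (if s \<le> r \<and> r \<le> l then T s r else 0))"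
  proof (rule sum.cong[OF refl])
    fix s assume "s \<in> {..l}"
    then have e: "gbin q (a + b + m - s) (a + b) * gbin q a s
        = (\<Sum>r\<le>m. if s \<le> r \<and> r \<le> l then T s r else 0) * gbin q a s"
      by (intro expand) simp
    have "q ^ (s * (s + (b - l))) * gbin q (a + b + m - s) (a + b) * gbin q a s * gbin q b (l - s)
       = q ^ (s * (s + (b - l))) * (gbin q (a + b + m - s) (a + b) * gbin q a s) * gbin q b (l - s)"
      by (simp only: mult_ac)
    then show "q ^ (s * (s + (b - l))) * gbin q (a + b + m - s) (a + b) * gbin q a s * gbin q b (l - s)
       = (\<Sum>r\<le>m. q ^ (s * (s + (b - l))) * gbin q a s * gbin q b (l - s) * (if s \<le> r \<and> r \<le> l then T s r else 0))"
      unfolding e sum_distrib_left [symmetric] by (simp only: mult_ac)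
  qed
  also have "\<dots> = (\<Sum>r\<le>m. \<Sum>s\<le>l. q ^ (s * (s + (b - l))) * gbin q a s * gbin q b (l - s) * (if s \<le> r \<and> r \<le> l then T s r else 0))"
    by (rule sum.swap)
  also have "\<dots> = (\<Sum>r\<le>m. if r \<le> l then gbin q (N + m) m * (q ^ ((l - r) * (m - r)) * gbin q m r * gbin q b (l - r)) else 0)"
    by (intro sum.cong refl inner) simp
  also have "\<dots> = (\<Sum>r\<le>l. gbin q (N + m) m * (q ^ ((l - r) * (m - r)) * gbin q m r * gbin q b (l - r)))"
    by (rule sum.mono_neutral_cong) auto
  also have "\<dots> = gbin q (N + m) m * (\<Sum>j\<le>l. q ^ (j * (m + j - l)) * gbin q m (l - j) * gbin q b j)"
    unfolding sum_distrib_left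
    by (rule sum.reindex_bij_witness[of _ "\<lambda>j. l - j" "\<lambda>r. l - r"]) auto
  also have "\<dots> = gbin q (N + m) m * gbin q (b + m) l"
    by (simp only: add.commute[of b m] q_vandermonde)
  finally show ?thesis
    unfolding N_def .
qed

end

section \<open>The finite Jacobi triple product\<close>

text \<open>The product \<open>n * (n - 1)\<close> is even and non-negative for every integer
  \<open>n\<close>, so neither \<open>div\<close> nor \<open>nat\<close> loses anything.\<close>

definition tri :: "int \<Rightarrow> nat" where
  "tri n = nat (n * (n - 1) div 2)"

lemma tri_int: "2 * int (tri n) = n * (n - 1)"
proof -
  have "even (n * (n - 1))" by simp
  moreover have "0 \<le> n * (n - 1)"
    by (cases "n \<le> 0") (auto simp: zero_le_mult_iff)
  ultimately show ?thesis
    by (simp add: tri_def)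
qed

lemma tri_reflect: "tri (1 - n) = tri n"
  using tri_int[of n] tri_int[of "1 - n"] by (simp add: algebra_simps)

lemma tri_Suc: "int (tri (n + 1)) = int (tri n) + n"
  using tri_int[of n] tri_int[of "n + 1"] by (simp add: algebra_simps)

lemma tri_simps [simp]: "tri 0 = 0" "tri 1 = 0"
  by (simp_all add: tri_def)

lemma tri_Suc_add: "int (tri (n + 1) + tri n) = n * n"
  using tri_int[of n] tri_Suc[of n] by (simp add: algebra_simps)

text \<open>The two triangular numbers add up to \<open>n * n\<close>, which has the parity of
  \<open>n\<close>. This converts the signs of a theta series with negative arguments into an
  alternating sign.\<close>

lemma minus_one_power_tri:
  "(- 1 :: complex) ^ tri (n + 1) * (- 1) ^ tri n = (- 1) ^ nat \<bar>n\<bar>"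
proof -
  have "even (tri (n + 1) + tri n) \<longleftrightarrow> even (n * n)"
    by (metis tri_Suc_add even_of_nat)
  then have "even (tri (n + 1) + tri n) \<longleftrightarrow> even (nat \<bar>n\<bar>)"
    by (simp add: even_nat_iff)
  then show ?thesis
    by (metis neg_one_even_power neg_one_odd_power power_add)
qed

text \<open>
  Ramanujan's form \<open>\<Sum>n. a^(n(n+1)/2) b^(n(n-1)/2)\<close> of the theta series has no negative powers, so
  that \<open>q = 0\<close> needs no separate treatment. The unequal ranges \<open>M\<close> and \<open>N\<close> make the induction a
  single use of Pascal's rule.
\<close>

definition theta_sum :: "complex \<Rightarrow> complex \<Rightarrow> nat \<Rightarrow> nat \<Rightarrow> complex" where
  "theta_sum a b M N =
     (\<Sum>j\<le>M + N. a ^ tri (int j - int N + 1) * b ^ tri (int j - int N) * gbin (a * b) (M + N) j)"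

text \<open>Reversing the order of summation reflects the triangular numbers. Growth in
  \<open>N\<close> thereby becomes growth in the first range, so one recurrence serves both.\<close>

lemma theta_sum_swap: "theta_sum a b 0 N = theta_sum b a N 0"
  unfolding theta_sum_def
proof (rule sum.reindex_bij_witness[of _ "\<lambda>j. N - j" "\<lambda>j. N - j"])
  fix j assume j: "j \<in> {..0 + N}"
  have "tri (int (N - j) - int 0 + 1) = tri (int j - int N)" "tri (int (N - j) - int 0) = tri (int j - int N + 1)"
    using j tri_reflect[of "int j - int N"] tri_reflect[of "int j - int N + 1"]
    by (simp_all add: of_nat_diff algebra_simps)
  then show "b ^ tri (int (N - j) - int 0 + 1) * a ^ tri (int (N - j) - int 0) * gbin (b * a) (N + 0) (N - j)
      = a ^ tri (int j - int N + 1) * b ^ tri (int j - int N) * gbin (a * b) (0 + N) j"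
    using j by (simp add: gbin_symm mult_ac)
qed auto

context
  fixes a b :: complex
  assumes ab: "norm (a * b) < 1"
begin

text \<open>Pascal's rule splits off a copy of the sum with its index shifted by one. By
  \<open>shift\<close>, the power of \<open>a * b\<close> from Pascal's rule offsets the growth of
  the triangular exponents, and the shifted copy is \<open>a * (a * b) ^ M\<close> times the
  original.\<close>

lemma theta_sum_Suc: "theta_sum a b (Suc M) N = (1 + a * (a * b) ^ M) * theta_sum a b M N"
proof -
  let ?K = "M + N" and ?Q = "a * b"
  define c where "c j = a ^ tri (int j - int N + 1) * b ^ tri (int j - int N)" for j
  have shift: "c (Suc j) * ?Q ^ (?K - j) = a * ?Q ^ M * c j" if j: "j \<le> ?K" for j
  proof -
    have "int (tri (int (Suc j) - int N + 1) + (?K - j)) = int (1 + M + tri (int j - int N + 1))"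
      using j tri_Suc[of "int j - int N + 1"] by (simp add: of_nat_diff algebra_simps)
    moreover have "int (tri (int (Suc j) - int N) + (?K - j)) = int (M + tri (int j - int N))"
      using j tri_Suc[of "int j - int N"] by (simp add: of_nat_diff algebra_simps)
    ultimately have e: "tri (int (Suc j) - int N + 1) + (?K - j) = 1 + M + tri (int j - int N + 1)"
      "tri (int (Suc j) - int N) + (?K - j) = M + tri (int j - int N)"
      by linarith+
    have "c (Suc j) * ?Q ^ (?K - j)
        = a ^ (tri (int (Suc j) - int N + 1) + (?K - j)) * b ^ (tri (int (Suc j) - int N) + (?K - j))"
      by (simp only: c_def power_add power_mult_distrib mult_ac)
    also have "\<dots> = a * ?Q ^ M * c j"
      unfolding e by (simp add: c_def power_add power_mult_distrib)
    finally show ?thesis .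
  qed
  have "theta_sum a b (Suc M) N = (\<Sum>j\<le>Suc ?K. c j * gbin ?Q (Suc ?K) j)"
    by (simp add: theta_sum_def c_def)
  also have "\<dots> = c 0 + (\<Sum>j\<le>?K. c (Suc j) * gbin ?Q (Suc ?K) (Suc j))"
    by (subst sum.atMost_Suc_shift) (simp add: gbin_0[OF ab])
  also have "(\<Sum>j\<le>?K. c (Suc j) * gbin ?Q (Suc ?K) (Suc j))
      = (\<Sum>j\<le>?K. c (Suc j) * gbin ?Q ?K (Suc j)) + (\<Sum>j\<le>?K. a * ?Q ^ M * (c j * gbin ?Q ?K j))"
    unfolding sum.distrib[symmetric]
  proof (rule sum.cong[OF refl])
    fix j assume "j \<in> {..?K}"
    then have j: "j \<le> ?K" by simp
    show "c (Suc j) * gbin ?Q (Suc ?K) (Suc j) = c (Suc j) * gbin ?Q ?K (Suc j) + a * ?Q ^ M * (c j * gbin ?Q ?K j)"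
      unfolding gbin_Suc_Suc'[OF ab j] mult.assoc[symmetric] shift[OF j, symmetric]
      by (simp add: algebra_simps)
  qed
  also have "c 0 + ((\<Sum>j\<le>?K. c (Suc j) * gbin ?Q ?K (Suc j)) + (\<Sum>j\<le>?K. a * ?Q ^ M * (c j * gbin ?Q ?K j)))
      = (\<Sum>j\<le>Suc ?K. c j * gbin ?Q ?K j) + a * ?Q ^ M * (\<Sum>j\<le>?K. c j * gbin ?Q ?K j)"
    by (subst sum.atMost_Suc_shift) (simp add: gbin_0[OF ab] sum_distrib_left)
  finally show ?thesis
    by (simp add: theta_sum_def c_def algebra_simps)
qed

lemma theta_sum_eq_prod:
  "theta_sum a b M N = (\<Prod>i<M. 1 + a * (a * b) ^ i) * theta_sum a b 0 N"
  by (induction M) (simp_all add: theta_sum_Suc mult_ac)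

end

text \<open>The first range grows from \<open>0\<close> to \<open>N\<close> and yields the product
  in \<open>a\<close>; after the swap the other one shrinks to \<open>0\<close> and yields the
  product in \<open>b\<close>.\<close>

lemma finite_jacobi_triple:
  assumes "norm (a * b) < 1"
  shows "(\<Sum>n=-int N..int N. a ^ tri (n + 1) * b ^ tri n * qbinom (a * b) (2 * int N) (int N + n))
    = (\<Prod>i<N. 1 + a * (a * b) ^ i) * (\<Prod>i<N. 1 + b * (a * b) ^ i)"
proof -
  have ba: "norm (b * a) < 1"
    using assms by (simp add: mult.commute)
  have "theta_sum a b N N = (\<Prod>i<N. 1 + a * (a * b) ^ i) * theta_sum b a N 0"
    using theta_sum_eq_prod[OF assms, of N N] by (simp only: theta_sum_swap[of a b N])
  also have "theta_sum b a N 0 = (\<Prod>i<N. 1 + b * (a * b) ^ i) * theta_sum b a 0 0"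
    using theta_sum_eq_prod[OF ba, of N 0] by (subst mult.commute[of a b])
  also have "theta_sum b a 0 0 = 1"
    by (simp add: theta_sum_def gbin_def)
  finally have "theta_sum a b N N = (\<Prod>i<N. 1 + a * (a * b) ^ i) * (\<Prod>i<N. 1 + b * (a * b) ^ i)"
    by simp
  moreover have "theta_sum a b N N
      = (\<Sum>n=-int N..int N. a ^ tri (n + 1) * b ^ tri n * qbinom (a * b) (2 * int N) (int N + n))"
    unfolding theta_sum_def
  proof (rule sum.reindex_bij_witness[of _ "\<lambda>n. nat (n + int N)" "\<lambda>j. int j - int N"])
    fix j :: nat
    have "qbinom (a * b) (2 * int N) (int N + (int j - int N)) = gbin (a * b) (N + N) j"
      by (subst qbinom_of_nat[symmetric]) simp
    then show "a ^ tri (int j - int N + 1) * b ^ tri (int j - int N) * qbinom (a * b) (2 * int N) (int N + (int j - int N))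
       = a ^ tri (int j - int N + 1) * b ^ tri (int j - int N) * gbin (a * b) (N + N) j"
      by (simp only:)
  qed auto
  ultimately show ?thesis by simp
qed

section \<open>Seed of the iteration: an alternating sum of products of two Gaussian
  binomials\<close>

context
  fixes q :: complex
  assumes norm_q: "norm q < 1"
begin

text \<open>The finite triple product at \<open>a = -1\<close>, \<open>b = -q\<close>, where
  \<open>a * b = q\<close>: the factor \<open>1 + a\<close> at \<open>i = 0\<close> is zero unless
  the product is empty. The cutoff \<open>R\<close> may exceed \<open>r\<close> because the extra
  binomials vanish.\<close>

lemma alternating_central_sum:
  assumes "r \<le> R"
  shows "(\<Sum>n=-int R..int R. (- 1) ^ nat \<bar>n\<bar> * q ^ tri n * qbinom q (2 * int r) (int r + n)) = (if r = 0 then 1 else 0)"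
proof -
  have "(\<Sum>n=-int R..int R. (- 1) ^ nat \<bar>n\<bar> * q ^ tri n * qbinom q (2 * int r) (int r + n))
      = (\<Sum>n=-int r..int r. (- 1) ^ nat \<bar>n\<bar> * q ^ tri n * qbinom q (2 * int r) (int r + n))"
    using assms by (intro sum.mono_neutral_right) (auto intro!: qbinom_eq_0)
  also have "\<dots> = (\<Sum>n=-int r..int r. (- 1) ^ tri (n + 1) * (- q) ^ tri n * qbinom (- 1 * - q) (2 * int r) (int r + n))"
    by (intro sum.cong refl) (simp add: minus_one_power_tri[symmetric] power_minus[of q])
  also have "\<dots> = (\<Prod>i<r. 1 + (- 1) * (- 1 * - q) ^ i) * (\<Prod>i<r. 1 + (- q) * (- 1 * - q) ^ i)"
    by (rule finite_jacobi_triple) (simp add: norm_q)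
  also have "\<dots> = (if r = 0 then 1 else 0)"
    by (cases r) (simp_all add: prod.lessThan_Suc_shift del: prod.lessThan_Suc)
  finally show ?thesis .
qed

text \<open>Isolates the dependence on \<open>n\<close> in a central binomial. For
  \<open>n \<ge> 0\<close> the first factor is expanded by \<open>q\<close>-Vandermonde and the
  factorials are regrouped; for \<open>n < 0\<close> both sides are even in
  \<open>n\<close>.\<close>

lemma qbinom_product_expansion:
  "qbinom q (int (L + M)) (int L + n) * qbinom q (int (L + M)) (int L - n)
   = (\<Sum>r\<le>min L M. q ^ ((L - r) * (M - r)) * (qpoch q q (L + M) / (qpoch q q (L - r) * qpoch q q (M - r) * qpoch q q (2 * r)))
        * qbinom q (2 * int r) (int r + n))" (is "?lhs n = ?rhs n")
proof -
  let ?P = "qpoch q q"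
  have nat: "?lhs (int n) = ?rhs (int n)" for n
  proof (cases "n \<le> min L M")
    case False
    then have "?lhs (int n) = 0"
      by (auto simp: qbinom_eq_0 not_le min_def split: if_splits)
    moreover have "?rhs (int n) = 0"
      using False by (intro sum.neutral) (auto simp: qbinom_eq_0)
    ultimately show ?thesis by simp
  next
    case True
    then have nL: "n \<le> L" and nM: "n \<le> M" by auto
    have "qbinom q (int (L + M)) (int L + int n) = qbinom q (int (L + M)) (int (M - n))"
      using nM by (subst qbinom_symm) (simp add: of_nat_diff algebra_simps)
    also have "\<dots> = gbin q ((L - n) + (M + n)) (M - n)"
      using nL by (simp only: qbinom_of_nat) (simp add: add.commute)
    also have "\<dots> = (\<Sum>j\<le>M - n. q ^ (j * ((L - n) + j - (M - n))) * gbin q (L - n) (M - n - j) * gbin q (M + n) j)"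
      by (rule q_vandermonde[OF norm_q])
    also have "\<dots> = (\<Sum>r\<in>{n..M}. q ^ ((M - r) * ((L - n) + (M - r) - (M - n))) * gbin q (L - n) (r - n) * gbin q (M + n) (M - r))"
      by (rule sum.reindex_bij_witness[of _ "\<lambda>r. M - r" "\<lambda>j. M - j"]) (use nM in \<open>auto simp: add.commute[of n]\<close>)
    also have "\<dots> = (\<Sum>r\<in>{n..min L M}. q ^ ((L - r) * (M - r)) * (gbin q (L - n) (r - n) * gbin q (M + n) (M - r)))"
    proof (rule sum.mono_neutral_cong_right)
      fix r assume r: "r \<in> {n..min L M}"
      have "(M - r) * ((L - n) + (M - r) - (M - n)) = (L - r) * (M - r)"
        using r by auto
      then show "q ^ ((M - r) * ((L - n) + (M - r) - (M - n))) * gbin q (L - n) (r - n) * gbin q (M + n) (M - r)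
         = q ^ ((L - r) * (M - r)) * (gbin q (L - n) (r - n) * gbin q (M + n) (M - r))"
        by (simp only: mult.assoc)
    qed (use nL in \<open>auto simp: not_le diff_less_mono\<close>)
    finally have "?lhs (int n) = (\<Sum>r\<in>{n..min L M}. q ^ ((L - r) * (M - r)) * (gbin q (L - n) (r - n) * gbin q (M + n) (M - r)))
        * gbin q (L + M) (L - n)"
      using nL by (simp add: qbinom_eq_gbin nat_diff_distrib nat_add_distrib)
    also have "\<dots> = (\<Sum>r\<in>{n..min L M}. q ^ ((L - r) * (M - r)) * (?P (L + M) / (?P (L - r) * ?P (M - r) * ?P (2 * r)))
        * qbinom q (2 * int r) (int r + int n))"
      unfolding sum_distrib_right
    proof (rule sum.cong[OF refl])
      fix r assume r: "r \<in> {n..min L M}"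
      then have "n \<le> r" "r \<le> L" "r \<le> M"
        by auto
      then obtain u v w where uvw: "r = n + u" "L = n + u + v" "M = n + u + w"
        by (metis le_iff_add)
      have *: "gbin q (L - n) (r - n) = ?P (L - n) / (?P (r - n) * ?P (L - r))"
        "gbin q (M + n) (M - r) = ?P (M + n) / (?P (M - r) * ?P (r + n))"
        "gbin q (L + M) (L - n) = ?P (L + M) / (?P (L - n) * ?P (M + n))"
        "gbin q (2 * r) (r + n) = ?P (2 * r) / (?P (r + n) * ?P (r - n))"
        unfolding uvw by (simp_all add: gbin_def add_ac)
      have central: "qbinom q (2 * int r) (int r + int n) = gbin q (2 * r) (r + n)"
        by (subst qbinom_of_nat [symmetric]) simp
      show "q ^ ((L - r) * (M - r)) * (gbin q (L - n) (r - n) * gbin q (M + n) (M - r)) * gbin q (L + M) (L - n)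
         = q ^ ((L - r) * (M - r)) * (?P (L + M) / (?P (L - r) * ?P (M - r) * ?P (2 * r))) * qbinom q (2 * int r) (int r + int n)"
        unfolding central * by (simp add: qfac_nz[OF norm_q])
    qed
    also have "\<dots> = ?rhs (int n)"
      by (intro sum.mono_neutral_left) (auto simp: qbinom_eq_0)
    finally show ?thesis .
  qed
  show ?thesis
  proof (cases "0 \<le> n")
    case True
    then show ?thesis using nat[of "nat n"] by simp
  next
    case False
    have rhs: "?rhs (- n) = ?rhs n"
    proof (rule sum.cong[OF refl])
      fix r
      have "qbinom q (2 * int r) (int r + - n) = qbinom q (2 * int r) (int r + n)"
        by (subst qbinom_symm) (simp add: algebra_simps)
      then show "q ^ ((L - r) * (M - r)) * (?P (L + M) / (?P (L - r) * ?P (M - r) * ?P (2 * r))) * qbinom q (2 * int r) (int r + - n)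
        = q ^ ((L - r) * (M - r)) * (?P (L + M) / (?P (L - r) * ?P (M - r) * ?P (2 * r))) * qbinom q (2 * int r) (int r + n)"
        by (simp only:)
    qed
    have lhs: "?lhs (- n) = ?lhs n"
      by (simp add: mult.commute)
    have "?lhs (- n) = ?rhs (- n)"
      using nat[of "nat (- n)"] False by simp
    then show ?thesis
      by (simp only: lhs rhs)
  qed
qed

text \<open>After the expansion of the product, the alternating sum over \<open>n\<close>
  annihilates every term except \<open>r = 0\<close>. The free cutoff \<open>R\<close> allows one
  range of \<open>n\<close> for all \<open>L\<close> at once.\<close>

lemma burge_seed:
  assumes "L \<le> R"
  shows "(\<Sum>n=-int R..int R. (- 1) ^ nat \<bar>n\<bar> * q ^ tri n
            * (qbinom q (int (L + M)) (int L + n) * qbinom q (int (L + M)) (int L - n)))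
         = q ^ (L * M) * gbin q (L + M) L"
proof -
  let ?P = "qpoch q q"
  let ?c = "\<lambda>r. q ^ ((L - r) * (M - r)) * (?P (L + M) / (?P (L - r) * ?P (M - r) * ?P (2 * r)))"
  have "(\<Sum>n=-int R..int R. (- 1) ^ nat \<bar>n\<bar> * q ^ tri n
            * (qbinom q (int (L + M)) (int L + n) * qbinom q (int (L + M)) (int L - n)))
     = (\<Sum>n=-int R..int R. \<Sum>r\<le>min L M. ?c r * ((- 1) ^ nat \<bar>n\<bar> * q ^ tri n * qbinom q (2 * int r) (int r + n)))"
    unfolding qbinom_product_expansion sum_distrib_left by (simp only: mult_ac)
  also have "\<dots> = (\<Sum>r\<le>min L M. ?c r * (\<Sum>n=-int R..int R. (- 1) ^ nat \<bar>n\<bar> * q ^ tri n * qbinom q (2 * int r) (int r + n)))"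
    by (subst sum.swap) (simp only: sum_distrib_left)
  also have "\<dots> = (\<Sum>r\<le>min L M. if r = 0 then ?c r else 0)"
  proof (rule sum.cong[OF refl])
    fix r assume "r \<in> {..min L M}"
    then have "r \<le> R" using assms by simp
    then show "?c r * (\<Sum>n=-int R..int R. (- 1) ^ nat \<bar>n\<bar> * q ^ tri n * qbinom q (2 * int r) (int r + n)) = (if r = 0 then ?c r else 0)"
      by (simp only: alternating_central_sum) simp
  qed
  also have "\<dots> = q ^ (L * M) * gbin q (L + M) L"
    by (simp add: gbin_def)
  finally show ?thesis .
qed

section \<open>The Burge transform\<close>

text \<open>Substitution \<open>i = b + s\<close> on the support of the binomials. The weight
  \<open>X\<close> is arbitrary so that the transform and its limit, where \<open>X\<close> is
  constantly \<open>1\<close>, share this computation.\<close>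

lemma burge_reindex:
  fixes a b L :: nat
  shows "(\<Sum>i\<le>L. q ^ i\<^sup>2 * X i * (qbinom q (int L + int a - int b) (int i - int b) * qbinom q (int L - int a + int b) (int i + int b)))
     = (if L < a + b then 0
        else q ^ b\<^sup>2 * (\<Sum>s\<le>L - a - b. q ^ (s * (s + 2 * b)) * X (b + s)
            * gbin q (2 * a + (L - a - b)) s * gbin q (2 * b + (L - a - b)) (L - a - b - s)))"
proof (cases "L < a + b")
  case True
  have "qbinom q (int L + int a - int b) (int i - int b) * qbinom q (int L - int a + int b) (int i + int b) = 0" for i
    by (cases "i < b") (use True in \<open>simp_all add: qbinom_eq_0\<close>)
  then show ?thesis
    using True by (simp only: mult_zero_right sum.neutral_const if_True)
next
  case False
  then obtain l where L: "L = a + b + l"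
    using le_Suc_ex not_less by blast
  have "(\<Sum>i\<le>L. q ^ i\<^sup>2 * X i * (qbinom q (int L + int a - int b) (int i - int b) * qbinom q (int L - int a + int b) (int i + int b)))
      = (\<Sum>i\<in>{b..b + l}. q ^ i\<^sup>2 * X i * (gbin q (2 * a + l) (i - b) * gbin q (2 * b + l) (l - (i - b))))"
  proof (rule sum.mono_neutral_cong_right)
    show "\<forall>i\<in>{..L} - {b..b + l}. q ^ i\<^sup>2 * X i * (qbinom q (int L + int a - int b) (int i - int b) * qbinom q (int L - int a + int b) (int i + int b)) = 0"
    proof
      fix i assume "i \<in> {..L} - {b..b + l}"
      then have "int i - int b < 0 \<or> int L - int a + int b < int i + int b"
        by (auto simp: L)
      then show "q ^ i\<^sup>2 * X i * (qbinom q (int L + int a - int b) (int i - int b) * qbinom q (int L - int a + int b) (int i + int b)) = 0"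
        using qbinom_eq_0 by fastforce
    qed
    fix i assume "i \<in> {b..b + l}"
    then obtain s where s: "i = b + s" "s \<le> l"
      using nat_le_iff_add by auto
    have "qbinom q (int L + int a - int b) (int i - int b) = gbin q (2 * a + l) s"
      by (subst qbinom_of_nat[symmetric]) (simp add: s L)
    moreover have "qbinom q (int L - int a + int b) (int i + int b) = gbin q (2 * b + l) (2 * b + s)"
      by (subst qbinom_of_nat[symmetric]) (simp add: s L)
    moreover have "gbin q (2 * b + l) (2 * b + s) = gbin q (2 * b + l) (l - s)"
      using gbin_symm[of "2 * b + s" "2 * b + l" q] s by simp
    ultimately show "q ^ i\<^sup>2 * X i * (qbinom q (int L + int a - int b) (int i - int b) * qbinom q (int L - int a + int b) (int i + int b))
       = q ^ i\<^sup>2 * X i * (gbin q (2 * a + l) (i - b) * gbin q (2 * b + l) (l - (i - b)))"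
      using s by simp
  qed (auto simp: L)
  also have "\<dots> = (\<Sum>s\<le>l. q ^ (b + s)\<^sup>2 * X (b + s) * (gbin q (2 * a + l) s * gbin q (2 * b + l) (l - s)))"
    by (rule sum.reindex_bij_witness[of _ "\<lambda>s. b + s" "\<lambda>i. i - b"]) auto
  also have "\<dots> = q ^ b\<^sup>2 * (\<Sum>s\<le>l. q ^ (s * (s + 2 * b)) * X (b + s) * gbin q (2 * a + l) s * gbin q (2 * b + l) (l - s))"
    unfolding sum_distrib_left
  proof (rule sum.cong[OF refl])
    fix s
    have "(b + s)\<^sup>2 = b\<^sup>2 + s * (s + 2 * b)"
      by (simp add: power2_eq_square algebra_simps)
    then show "q ^ (b + s)\<^sup>2 * X (b + s) * (gbin q (2 * a + l) s * gbin q (2 * b + l) (l - s))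
       = q ^ b\<^sup>2 * (q ^ (s * (s + 2 * b)) * X (b + s) * gbin q (2 * a + l) s * gbin q (2 * b + l) (l - s))"
      by (simp add: power_add mult_ac)
  qed
  finally show ?thesis
    by (simp add: L)
qed

text \<open>With \<open>L = a + b + l\<close> and \<open>M = b + m\<close> the reindexed sum is the
  \<open>q\<close>-Saalschuetz sum with parameters \<open>2 * a + l\<close> and
  \<open>2 * b + l\<close>. If \<open>L < a + b\<close> or \<open>M < b\<close>, both sides
  vanish.\<close>

lemma burge_transform_nat:
  fixes a b L M :: nat
  shows "(\<Sum>i\<le>L. q ^ i\<^sup>2 * gbin q (2 * L + M - i) (2 * L)
            * (qbinom q (int L + int a - int b) (int i - int b) * qbinom q (int L - int a + int b) (int i + int b)))
     = q ^ b\<^sup>2 * (qbinom q (int L + int M + int a) (int L + int a + int b) * qbinom q (int L + int M - int a) (int L - int a - int b))"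
proof (cases "L < a + b")
  case True
  then show ?thesis
    by (subst burge_reindex) (simp add: qbinom_eq_0)
next
  case False
  then obtain l where L: "L = a + b + l"
    using le_Suc_ex not_less by blast
  show ?thesis
  proof (cases "M < b")
    case True
    have "gbin q (2 * L + M - (b + s)) (2 * L) = 0" for s
      using True by (intro gbin_eq_0) (simp add: L)
    then show ?thesis
      using True by (subst burge_reindex) (simp add: qbinom_eq_0)
  next
    case False
    then obtain m where M: "M = b + m"
      using le_Suc_ex not_less by blast
    have "(\<Sum>s\<le>l. q ^ (s * (s + 2 * b)) * gbin q (2 * L + M - (b + s)) (2 * L) * gbin q (2 * a + l) s * gbin q (2 * b + l) (l - s))
       = gbin q (2 * a + 2 * b + l + m) m * gbin q (2 * b + l + m) l"
      using q_saalschuetz[OF norm_q, of l "2 * b + l" "2 * a + l" m] by (simp add: L M algebra_simps)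
    moreover have "qbinom q (int L + int M + int a) (int L + int a + int b) = gbin q (2 * a + 2 * b + l + m) m"
      by (subst qbinom_of_nat[symmetric], subst qbinom_symm) (simp add: L M add.assoc)
    moreover have "qbinom q (int L + int M - int a) (int L - int a - int b) = gbin q (2 * b + l + m) l"
      by (subst qbinom_of_nat[symmetric]) (simp add: L M add.assoc)
    moreover have "L - a - b = l" "\<not> L < a + b"
      by (simp_all add: L)
    ultimately show ?thesis
      by (subst burge_reindex) (simp only: if_False)
  qed
qed

text \<open>Without the factor depending on \<open>M\<close>, the reindexed sum is a plain
  \<open>q\<close>-Vandermonde sum.\<close>

lemma burge_transform_limit_nat:
  fixes a b L :: nat
  shows "(\<Sum>i\<le>L. q ^ i\<^sup>2 * (qbinom q (int L + int a - int b) (int i - int b) * qbinom q (int L - int a + int b) (int i + int b)))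
     = q ^ b\<^sup>2 * qbinom q (2 * int L) (int L - int a - int b)"
proof (cases "L < a + b")
  case True
  then show ?thesis
    using burge_reindex[of "\<lambda>_. 1" L a b] by (simp add: qbinom_eq_0)
next
  case False
  then obtain l where L: "L = a + b + l"
    using le_Suc_ex not_less by blast
  have "(\<Sum>s\<le>l. q ^ (s * (s + 2 * b)) * gbin q (2 * a + l) s * gbin q (2 * b + l) (l - s)) = gbin q (2 * L) l"
    using q_vandermonde[OF norm_q, of "2 * b + l" "2 * a + l" l] by (simp add: L algebra_simps)
  moreover have "qbinom q (2 * int L) (int L - int a - int b) = gbin q (2 * L) l"
    by (subst qbinom_of_nat[symmetric]) (simp add: L)
  ultimately show ?thesis
    using burge_reindex[of "\<lambda>_. 1" L a b] by (simp add: L)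
qed

text \<open>
  Some condition on the signs is needed: for \<open>q \<noteq> 0\<close>, \<open>L = 0\<close>, \<open>a = -b \<noteq> 0\<close> and \<open>M \<ge> \<bar>b\<bar>\<close> the left-hand
  side is zero and the right-hand side is not.
\<close>

lemma burge_transform:
  fixes L M :: nat and a b :: int
  assumes "0 \<le> a \<and> 0 \<le> b \<or> a \<le> 0 \<and> b \<le> 0"
  shows "(\<Sum>i\<le>L. q ^ i\<^sup>2 * gbin q (2 * L + M - i) (2 * L)
            * (qbinom q (int L + a - b) (int i - b) * qbinom q (int L - a + b) (int i + b)))
     = q ^ nat (b\<^sup>2) * (qbinom q (int L + int M + a) (int L + a + b) * qbinom q (int L + int M - a) (int L - a - b))"
  using assms
proof
  assume "0 \<le> a \<and> 0 \<le> b"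
  then show ?thesis
    using burge_transform_nat[of L M "nat a" "nat b"] by (simp add: nat_power_eq)
next
  \<comment> \<open>Changing the sign of both parameters merely exchanges the two binomial factors
    on each side.\<close>
  assume *: "a \<le> 0 \<and> b \<le> 0"
  then have "nat (b\<^sup>2) = (nat (- b))\<^sup>2"
    by (metis nat_power_eq neg_0_le_iff_le power2_minus)
  then show ?thesis
    using burge_transform_nat[of L M "nat (- a)" "nat (- b)"] * by (simp add: mult.commute mult.left_commute)
qed

lemma burge_transform_limit:
  fixes L :: nat and a b :: int
  assumes "0 \<le> a \<and> 0 \<le> b \<or> a \<le> 0 \<and> b \<le> 0"
  shows "(\<Sum>i\<le>L. q ^ i\<^sup>2 * (qbinom q (int L + a - b) (int i - b) * qbinom q (int L - a + b) (int i + b)))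
     = q ^ nat (b\<^sup>2) * qbinom q (2 * int L) (int L - a - b)"
  using assms
proof
  assume "0 \<le> a \<and> 0 \<le> b"
  then show ?thesis
    using burge_transform_limit_nat[of L "nat a" "nat b"] by (simp add: nat_power_eq)
next
  assume *: "a \<le> 0 \<and> b \<le> 0"
  then have "nat (b\<^sup>2) = (nat (- b))\<^sup>2"
    by (metis nat_power_eq neg_0_le_iff_le power2_minus)
  \<comment> \<open>Here the right-hand side has a single binomial, and its symmetry absorbs the
    change of signs.\<close>
  moreover have "qbinom q (2 * int L) (int L - a - b) = qbinom q (2 * int L) (int L + a + b)"
    by (subst qbinom_symm) (simp add: algebra_simps)
  ultimately show ?thesis
    using burge_transform_limit_nat[of L "nat (- a)" "nat (- b)"] * by (simp add: mult.commute mult.left_commute)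
qed

end

section \<open>Iterating the transform\<close>

text \<open>
  With \<open>t = k - 2 - j\<close>, the value \<open>chain_sum q t a b\<close> is the sum over \<open>m_(j+1), \<dots>, m_(k-2)\<close> of
  the factors of the summand that belong to the indices from \<open>j\<close> on, for \<open>m_(j-1) = a\<close> and \<open>m_j = b\<close>.
\<close>

fun chain_sum :: "complex \<Rightarrow> nat \<Rightarrow> nat \<Rightarrow> nat \<Rightarrow> complex" where
  "chain_sum q 0 a b = q ^ (a * b) * gbin q a b"
| "chain_sum q (Suc t) a b =
     q ^ b\<^sup>2 * (\<Sum>c\<le>b. qbinom q (int a + int b - int c) (2 * int b) * chain_sum q t b c)"

text \<open>The sum of the squares of \<open>F_2, ..., F_(t+1)\<close>: the coefficient of
  \<open>n^2\<close> gathered in \<open>t\<close> transforms, the first of which has second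
  parameter \<open>F_2 n\<close>.\<close>

fun fib_exp :: "nat \<Rightarrow> nat" where
  "fib_exp 0 = 0"
| "fib_exp (Suc t) = fib_exp t + (fib (t + 2))\<^sup>2"

text \<open>The classical sum of squares of Fibonacci numbers; the added \<open>1\<close> is the
  missing square of \<open>F_1\<close>.\<close>

lemma fib_exp_eq: "fib_exp t + 1 = fib (t + 1) * fib (t + 2)"
  by (induction t) (auto simp: power2_eq_square algebra_simps)

text \<open>The seed contributes the sign and \<open>tri n\<close>; \<open>e\<close> is the
  coefficient of \<open>n^2\<close> accumulated by the transforms and Bailey steps.\<close>

definition theta_coeff :: "complex \<Rightarrow> nat \<Rightarrow> int \<Rightarrow> complex" where
  "theta_coeff q e n = (- 1) ^ nat \<bar>n\<bar> * q ^ (tri n + e * nat (n\<^sup>2))"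

lemma theta_coeff_add: "theta_coeff q (d + e\<^sup>2) n = theta_coeff q d n * q ^ nat ((int e * n)\<^sup>2)"
proof -
  have "nat ((int e * n)\<^sup>2) = e\<^sup>2 * nat (n\<^sup>2)"
    by (simp add: power_mult_distrib nat_mult_distrib nat_power_eq)
  then show ?thesis
    by (simp add: theta_coeff_def power_add algebra_simps)
qed

lemma chain_sum_eq_0: "a < b \<Longrightarrow> chain_sum q t a b = 0"
  by (cases t) (auto intro!: sum.neutral simp: qbinom_eq_0)

context
  fixes q :: complex
  assumes norm_q: "norm q < 1"
begin

text \<open>Induction on \<open>t\<close>. The base case is \<open>burge_seed\<close> with
  \<open>L = b\<close>, \<open>M = a - b\<close>; the step is the Burge transform with parameters
  \<open>F_(t+1) n\<close> and \<open>F_(t+2) n\<close>. The cutoff \<open>R\<close> does not depend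
  on \<open>b\<close>, so the sums over \<open>c\<close> and \<open>n\<close> can be
  exchanged.\<close>

lemma chain_sum_eq:
  assumes "b \<le> a" "b \<le> R"
  shows "chain_sum q t a b = q ^ b\<^sup>2 * (\<Sum>n=-int R..int R. theta_coeff q (fib_exp t) n *
     (qbinom q (int a + int (fib t) * n) (int b + int (fib (t + 2)) * n)
      * qbinom q (int a - int (fib t) * n) (int b - int (fib (t + 2)) * n)))"
  using assms
proof (induction t arbitrary: a b)
  case 0
  have "a * b = b\<^sup>2 + b * (a - b)"
    using 0 by (metis add_mult_distrib2 le_add_diff_inverse mult.commute power2_eq_square)
  then have "chain_sum q 0 a b = q ^ b\<^sup>2 * (q ^ (b * (a - b)) * gbin q (b + (a - b)) b)"
    using 0 by (simp add: power_add)
  also have "q ^ (b * (a - b)) * gbin q (b + (a - b)) b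
     = (\<Sum>n=-int R..int R. (- 1) ^ nat \<bar>n\<bar> * q ^ tri n
            * (qbinom q (int (b + (a - b))) (int b + n) * qbinom q (int (b + (a - b))) (int b - n)))"
    using 0 by (intro burge_seed[OF norm_q, symmetric])
  finally show ?case
    using 0 by (simp add: theta_coeff_def numeral_2_eq_2)
next
  case (Suc t)
  let ?F = "\<lambda>k n. int (fib (t + k)) * n"
  have "chain_sum q (Suc t) a b
      = q ^ b\<^sup>2 * (\<Sum>c\<le>b. qbinom q (int a + int b - int c) (2 * int b) * chain_sum q t b c)"
    by simp
  also have "(\<Sum>c\<le>b. qbinom q (int a + int b - int c) (2 * int b) * chain_sum q t b c)
     = (\<Sum>c\<le>b. \<Sum>n=-int R..int R. theta_coeff q (fib_exp t) n *
          (q ^ c\<^sup>2 * gbin q (2 * b + (a - b) - c) (2 * b) *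
            (qbinom q (int b + ?F 1 n - ?F 2 n) (int c - ?F 2 n) * qbinom q (int b - ?F 1 n + ?F 2 n) (int c + ?F 2 n))))"
  proof (rule sum.cong[OF refl])
    fix c assume c: "c \<in> {..b}"
    have g: "qbinom q (int a + int b - int c) (2 * int b) = gbin q (2 * b + (a - b) - c) (2 * b)"
      using c Suc.prems by (subst qbinom_of_nat[symmetric]) (simp add: of_nat_diff algebra_simps)
    \<comment> \<open>The recurrence \<open>F_t = F_(t+2) - F_(t+1)\<close> brings the induction
      hypothesis into the shape of the left-hand side of the transform.\<close>
    have F: "int b + int (fib t) * n = int b - ?F 1 n + ?F 2 n" "int b - int (fib t) * n = int b + ?F 1 n - ?F 2 n" for n
      by (simp_all add: algebra_simps)
    have "chain_sum q t b c = q ^ c\<^sup>2 * (\<Sum>n=-int R..int R. theta_coeff q (fib_exp t) n *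
       (qbinom q (int b + int (fib t) * n) (int c + ?F 2 n) * qbinom q (int b - int (fib t) * n) (int c - ?F 2 n)))"
      using c Suc.prems by (intro Suc.IH) auto
    then show "qbinom q (int a + int b - int c) (2 * int b) * chain_sum q t b c
       = (\<Sum>n=-int R..int R. theta_coeff q (fib_exp t) n *
          (q ^ c\<^sup>2 * gbin q (2 * b + (a - b) - c) (2 * b) *
            (qbinom q (int b + ?F 1 n - ?F 2 n) (int c - ?F 2 n) * qbinom q (int b - ?F 1 n + ?F 2 n) (int c + ?F 2 n))))"
      unfolding g F by (simp only: sum_distrib_left mult_ac)
  qed
  also have "\<dots> = (\<Sum>n=-int R..int R. theta_coeff q (fib_exp t) n * (\<Sum>c\<le>b. q ^ c\<^sup>2 * gbin q (2 * b + (a - b) - c) (2 * b) *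
            (qbinom q (int b + ?F 1 n - ?F 2 n) (int c - ?F 2 n) * qbinom q (int b - ?F 1 n + ?F 2 n) (int c + ?F 2 n))))"
    by (subst sum.swap) (simp only: sum_distrib_left)
  also have "\<dots> = (\<Sum>n=-int R..int R. theta_coeff q (fib_exp (Suc t)) n *
     (qbinom q (int a + int (fib (Suc t)) * n) (int b + int (fib (Suc t + 2)) * n)
      * qbinom q (int a - int (fib (Suc t)) * n) (int b - int (fib (Suc t + 2)) * n)))"
  proof (rule sum.cong[OF refl])
    fix n
    \<comment> \<open>Neither multiple has a sign opposite to that of \<open>n\<close>, as the sign
      condition of the transform demands.\<close>
    have "0 \<le> ?F 1 n \<and> 0 \<le> ?F 2 n \<or> ?F 1 n \<le> 0 \<and> ?F 2 n \<le> 0"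
      by (cases "0 \<le> n") (simp_all add: mult_nonneg_nonpos)
    then have *: "(\<Sum>c\<le>b. q ^ c\<^sup>2 * gbin q (2 * b + (a - b) - c) (2 * b) *
            (qbinom q (int b + ?F 1 n - ?F 2 n) (int c - ?F 2 n) * qbinom q (int b - ?F 1 n + ?F 2 n) (int c + ?F 2 n)))
       = q ^ nat ((?F 2 n)\<^sup>2) * (qbinom q (int b + int (a - b) + ?F 1 n) (int b + ?F 1 n + ?F 2 n)
            * qbinom q (int b + int (a - b) - ?F 1 n) (int b - ?F 1 n - ?F 2 n))"
      by (rule burge_transform[OF norm_q])
    have F: "int b + int (a - b) = int a" "int b + ?F 1 n + ?F 2 n = int b + int (fib (Suc t + 2)) * n"
      "int b - ?F 1 n - ?F 2 n = int b - int (fib (Suc t + 2)) * n"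
      using Suc.prems by (simp_all add: algebra_simps)
    show "theta_coeff q (fib_exp t) n * (\<Sum>c\<le>b. q ^ c\<^sup>2 * gbin q (2 * b + (a - b) - c) (2 * b) *
            (qbinom q (int b + ?F 1 n - ?F 2 n) (int c - ?F 2 n) * qbinom q (int b - ?F 1 n + ?F 2 n) (int c + ?F 2 n)))
       = theta_coeff q (fib_exp (Suc t)) n *
     (qbinom q (int a + int (fib (Suc t)) * n) (int b + int (fib (Suc t + 2)) * n)
      * qbinom q (int a - int (fib (Suc t)) * n) (int b - int (fib (Suc t + 2)) * n))"
      unfolding * F fib_exp.simps theta_coeff_add by (simp add: mult_ac)
  qed
  finally show ?case .
qed

text \<open>This is the sum over \<open>m_3\<close>. It carries no binomial that links it to an
  earlier index, so the limiting transform applies and leaves a single central binomial.\<close>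

lemma sum_chain_sum:
  assumes "a \<le> R"
  shows "(\<Sum>b\<le>a. chain_sum q t a b)
    = (\<Sum>n=-int R..int R. theta_coeff q (fib_exp (Suc t)) n * qbinom q (2 * int a) (int a - int (fib (t + 3)) * n))"
proof -
  let ?F = "\<lambda>k n. int (fib (t + k)) * n"
  have "(\<Sum>b\<le>a. chain_sum q t a b) = (\<Sum>b\<le>a. \<Sum>n=-int R..int R. theta_coeff q (fib_exp t) n *
          (q ^ b\<^sup>2 * (qbinom q (int a + ?F 1 n - ?F 2 n) (int b - ?F 2 n) * qbinom q (int a - ?F 1 n + ?F 2 n) (int b + ?F 2 n))))"
  proof (rule sum.cong[OF refl])
    fix b assume b: "b \<in> {..a}"
    have F: "int a + int (fib t) * n = int a - ?F 1 n + ?F 2 n" "int a - int (fib t) * n = int a + ?F 1 n - ?F 2 n" for n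
      by (simp_all add: algebra_simps)
    have "chain_sum q t a b = q ^ b\<^sup>2 * (\<Sum>n=-int R..int R. theta_coeff q (fib_exp t) n *
       (qbinom q (int a + int (fib t) * n) (int b + ?F 2 n) * qbinom q (int a - int (fib t) * n) (int b - ?F 2 n)))"
      using b assms by (intro chain_sum_eq) auto
    then show "chain_sum q t a b = (\<Sum>n=-int R..int R. theta_coeff q (fib_exp t) n *
          (q ^ b\<^sup>2 * (qbinom q (int a + ?F 1 n - ?F 2 n) (int b - ?F 2 n) * qbinom q (int a - ?F 1 n + ?F 2 n) (int b + ?F 2 n))))"
      unfolding F by (simp only: sum_distrib_left mult_ac)
  qed
  also have "\<dots> = (\<Sum>n=-int R..int R. theta_coeff q (fib_exp t) n * (\<Sum>b\<le>a. q ^ b\<^sup>2 *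
      (qbinom q (int a + ?F 1 n - ?F 2 n) (int b - ?F 2 n) * qbinom q (int a - ?F 1 n + ?F 2 n) (int b + ?F 2 n))))"
    by (subst sum.swap) (simp only: sum_distrib_left)
  also have "\<dots> = (\<Sum>n=-int R..int R. theta_coeff q (fib_exp (Suc t)) n * qbinom q (2 * int a) (int a - int (fib (t + 3)) * n))"
  proof (rule sum.cong[OF refl])
    fix n
    have "0 \<le> ?F 1 n \<and> 0 \<le> ?F 2 n \<or> ?F 1 n \<le> 0 \<and> ?F 2 n \<le> 0"
      by (cases "0 \<le> n") (simp_all add: mult_nonneg_nonpos)
    then have *: "(\<Sum>b\<le>a. q ^ b\<^sup>2 *
      (qbinom q (int a + ?F 1 n - ?F 2 n) (int b - ?F 2 n) * qbinom q (int a - ?F 1 n + ?F 2 n) (int b + ?F 2 n)))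
       = q ^ nat ((?F 2 n)\<^sup>2) * qbinom q (2 * int a) (int a - ?F 1 n - ?F 2 n)"
      by (rule burge_transform_limit[OF norm_q])
    have F: "int a - ?F 1 n - ?F 2 n = int a - int (fib (t + 3)) * n"
      by (simp add: numeral_3_eq_3 algebra_simps)
    show "theta_coeff q (fib_exp t) n * (\<Sum>b\<le>a. q ^ b\<^sup>2 *
      (qbinom q (int a + ?F 1 n - ?F 2 n) (int b - ?F 2 n) * qbinom q (int a - ?F 1 n + ?F 2 n) (int b + ?F 2 n)))
       = theta_coeff q (fib_exp (Suc t)) n * qbinom q (2 * int a) (int a - int (fib (t + 3)) * n)"
      unfolding * F fib_exp.simps theta_coeff_add by (simp add: mult_ac)
  qed
  finally show ?thesis .
qed

end

section \<open>Limits: the Bailey lemma and the Jacobi triple product\<close>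

text \<open>Dominated convergence for series: the Weierstrass test makes the finite partial sums
  converge uniformly in \<open>n\<close>, so the two limits may be exchanged.\<close>

lemma tendsto_infsum_dominated:
  fixes f :: "nat \<Rightarrow> 'a \<Rightarrow> 'b :: banach"
  assumes bound: "\<And>n x. x \<in> A \<Longrightarrow> norm (f n x) \<le> g x"
    and g: "g summable_on A"
    and lim: "\<And>x. x \<in> A \<Longrightarrow> (\<lambda>n. f n x) \<longlonglongrightarrow> h x"
  shows "(\<lambda>n. infsum (f n) A) \<longlonglongrightarrow> infsum h A" and "h summable_on A"
proof -
  have "norm (h x) \<le> g x" if "x \<in> A" for x
    using lim[OF that] bound[OF that] by (intro Lim_bounded[OF tendsto_norm]) auto
  then have "(\<lambda>x. norm (h x)) summable_on A"
    by (intro summable_on_comparison_test[OF g]) auto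
  then show h: "h summable_on A"
    by (rule abs_summable_summable)
  have "uniform_limit UNIV (\<lambda>X n. \<Sum>x\<in>X. f n x) (\<lambda>n. infsum (f n) A) (finite_subsets_at_top A)"
    using bound g by (rule Weierstrass_m_test_general)
  then show "(\<lambda>n. infsum (f n) A) \<longlonglongrightarrow> infsum h A"
  proof (rule swap_uniform_limit'[rotated 2])
    show "\<forall>\<^sub>F X in finite_subsets_at_top A. (\<lambda>n. \<Sum>x\<in>X. f n x) \<longlonglongrightarrow> (\<Sum>x\<in>X. h x)"
      by (intro eventually_finite_subsets_at_top_weakI tendsto_sum lim) auto
    show "(sum h \<longlongrightarrow> infsum h A) (finite_subsets_at_top A)"
      using h by (rule infsum_tendsto)
  qed auto
qed

lemma summable_on_power_nat: "0 \<le> r \<Longrightarrow> r < 1 \<Longrightarrow> (\<lambda>n::nat. r ^ n) summable_on UNIV" for r :: real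
  by (intro norm_summable_imp_summable_on) (simp add: summable_geometric)

lemma summable_on_power_int:
  fixes r :: real
  assumes "0 \<le> r" "r < 1"
  shows "(\<lambda>n::int. r ^ nat \<bar>n\<bar>) summable_on UNIV"
proof -
  have "(\<lambda>n::int. r ^ nat \<bar>n\<bar>) summable_on {0..}"
    using summable_on_power_nat[OF assms]
    by (rule summable_on_reindex_bij_witness[where i = nat and j = int, THEN iffD1, rotated -1]) auto
  moreover have "(\<lambda>n::int. r ^ nat \<bar>n\<bar>) summable_on {..0}"
    using summable_on_power_nat[OF assms]
    by (rule summable_on_reindex_bij_witness[where i = "\<lambda>n. nat (- n)" and j = "\<lambda>n. - int n", THEN iffD1, rotated -1]) auto
  ultimately have "(\<lambda>n::int. r ^ nat \<bar>n\<bar>) summable_on {0..} \<union> {..0}"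
    by (rule summable_on_union)
  moreover have "{0..} \<union> {..0} = (UNIV :: int set)"
    by auto
  ultimately show ?thesis by simp
qed

text \<open>The kernel \<open>1 / ((q)_(N-r) (q)_(N+r))\<close> with
  \<open>r = \<bar>x\<bar>\<close> of Bailey pairs relative to \<open>1\<close>, zero for
  \<open>r > N\<close>. It is written with the central binomial in which
  \<open>sum_chain_sum\<close> ends.\<close>

definition bailey_beta :: "complex \<Rightarrow> nat \<Rightarrow> int \<Rightarrow> complex" where
  "bailey_beta q N x = qbinom q (2 * int N) (int N - x) / qpoch q q (2 * N)"

context
  fixes q :: complex
  assumes norm_q: "norm q < 1"
begin

lemma qpoch_convergent:
  assumes "norm a < 1"
  shows qpoch_tendsto: "qpoch a q \<longlonglongrightarrow> qpoch_inf a q" and qpoch_inf_nz: "qpoch_inf a q \<noteq> 0"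
proof -
  have nz: "1 - a * q ^ i \<noteq> 0" for i
  proof
    assume "1 - a * q ^ i = 0"
    then have "norm a * norm q ^ i = 1"
      by (metis norm_mult norm_one norm_power right_minus_eq)
    moreover have "norm a * norm q ^ i \<le> norm a * 1"
      using norm_q by (intro mult_left_mono power_le_one) auto
    ultimately show False
      using assms by simp
  qed
  have "summable (\<lambda>i. norm (- (a * q ^ i)))"
    using norm_q by (simp add: norm_mult norm_power summable_geometric summable_mult)
  moreover have "- (a * q ^ i) \<noteq> - 1" for i
    using nz[of i] by (metis eq_iff_diff_eq_0 minus_equation_iff)
  ultimately have conv: "convergent_prod (\<lambda>i. 1 - a * q ^ i)"
    using summable_imp_convergent_prod_complex[of "\<lambda>i. - (a * q ^ i)"] by simp
  have "(\<lambda>n. \<Prod>i\<le>n. 1 - a * q ^ i) \<longlonglongrightarrow> qpoch_inf a q"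
    using convergent_prod_LIMSEQ[OF conv] by (simp add: qpoch_inf_def)
  then show "qpoch a q \<longlonglongrightarrow> qpoch_inf a q"
    by (simp add: qpoch_def[abs_def] LIMSEQ_lessThan_iff_atMost)
  show "qpoch_inf a q \<noteq> 0"
    unfolding qpoch_inf_def using conv nz by (rule prodinf_nonzero)
qed

lemmas qfac_tendsto = qpoch_tendsto[OF norm_q] and qfac_inf_nz = qpoch_inf_nz[OF norm_q]

text \<open>The sequence \<open>(q)_n\<close> converges to a non-zero limit, so it and its
  reciprocals are bounded. The single constant \<open>C\<close> feeds the dominations below.\<close>

lemma qfac_bounds:
  obtains C where "1 \<le> C" "\<And>n. norm (qpoch q q n) \<le> C" "\<And>n. norm (1 / qpoch q q n) \<le> C"
    "\<And>n k. norm (gbin q n k) \<le> C"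
proof -
  have "Bseq (qpoch q q)" "Bseq (\<lambda>n. 1 / qpoch q q n)"
    using qfac_tendsto tendsto_divide[OF tendsto_const qfac_tendsto qfac_inf_nz]
    by (blast intro: convergentI convergent_imp_Bseq)+
  then obtain A B where A: "0 < A" "\<And>n. norm (qpoch q q n) \<le> A" and B: "0 < B" "\<And>n. norm (1 / qpoch q q n) \<le> B"
    by (metis BseqE)
  define C where "C = max 1 (max A (max B (A * B * B)))"
  have "norm (gbin q n k) \<le> A * B * B" for n k
  proof (cases "k \<le> n")
    case True
    then have "gbin q n k = qpoch q q n * (1 / qpoch q q k) * (1 / qpoch q q (n - k))"
      by (simp add: gbin_def)
    then show ?thesis
      using A B by (simp only: norm_mult) (intro mult_mono mult_nonneg_nonneg, auto intro: less_imp_le)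
  next
    case False
    then show ?thesis
      using A B by simp
  qed
  moreover have "A \<le> C" "B \<le> C" "A * B * B \<le> C" "1 \<le> C"
    by (auto simp: C_def)
  ultimately show thesis
    using A B by (intro that[of C]) (meson order_trans)+
qed

section \<open>Durfee rectangle sums and the Bailey lemma relative to \<open>1\<close>\<close>

lemma gbin_tendsto: "(\<lambda>n. gbin q n k) \<longlonglongrightarrow> 1 / qpoch q q k"
proof (rule LIMSEQ_offset)
  have "(\<lambda>n. qpoch q q (n + k) / (qpoch q q k * qpoch q q n)) \<longlonglongrightarrow> qpoch_inf q q / (qpoch q q k * qpoch_inf q q)"
    using norm_q qfac_inf_nz
    by (intro tendsto_intros LIMSEQ_ignore_initial_segment qfac_tendsto) (simp add: qfac_nz)
  then show "(\<lambda>n. gbin q (n + k) k) \<longlonglongrightarrow> 1 / qpoch q q k"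
    using qfac_inf_nz by (simp add: gbin_def)
qed

text \<open>The limit of \<open>q\<close>-Vandermonde as the top \<open>n\<close> of one binomial
  tends to infinity, divided by \<open>(q)_(k+e)\<close>.\<close>

lemma durfee_finite:
  "(\<Sum>j\<le>k. q ^ (j * (j + e)) / (qpoch q q (k - j) * qpoch q q (e + j) * qpoch q q j))
    = 1 / (qpoch q q k * qpoch q q (k + e))"
proof -
  have "(\<lambda>n. \<Sum>j\<le>k. q ^ (j * (j + e)) * gbin q (k + e) (k - j) * gbin q n j)
     \<longlonglongrightarrow> (\<Sum>j\<le>k. q ^ (j * (j + e)) * gbin q (k + e) (k - j) * (1 / qpoch q q j))"
    by (intro tendsto_intros gbin_tendsto)
  moreover have "(\<Sum>j\<le>k. q ^ (j * (j + e)) * gbin q (k + e) (k - j) * gbin q n j) = gbin q (n + (k + e)) k" for n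
    using q_vandermonde[OF norm_q, of "k + e" n k] by (simp add: add_ac)
  moreover have "(\<lambda>n. gbin q (n + (k + e)) k) \<longlonglongrightarrow> 1 / qpoch q q k"
    by (intro LIMSEQ_ignore_initial_segment gbin_tendsto)
  ultimately have "(\<Sum>j\<le>k. q ^ (j * (j + e)) * gbin q (k + e) (k - j) * (1 / qpoch q q j)) = 1 / qpoch q q k"
    using LIMSEQ_unique by simp
  moreover have "(\<Sum>j\<le>k. q ^ (j * (j + e)) * gbin q (k + e) (k - j) * (1 / qpoch q q j))
     = qpoch q q (k + e) * (\<Sum>j\<le>k. q ^ (j * (j + e)) / (qpoch q q (k - j) * qpoch q q (e + j) * qpoch q q j))"
    unfolding sum_distrib_left
  proof (rule sum.cong[OF refl])
    fix j assume "j \<in> {..k}"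
    then have "k + e - (k - j) = e + j" "k - j \<le> k + e"
      by auto
    then have "gbin q (k + e) (k - j) = qpoch q q (k + e) / (qpoch q q (k - j) * qpoch q q (e + j))"
      by (simp add: gbin_def)
    then show "q ^ (j * (j + e)) * gbin q (k + e) (k - j) * (1 / qpoch q q j)
      = qpoch q q (k + e) * (q ^ (j * (j + e)) / (qpoch q q (k - j) * qpoch q q (e + j) * qpoch q q j))"
      by simp
  qed
  ultimately show ?thesis
    using qfac_nz[OF norm_q] by (simp add: field_simps)
qed

text \<open>Lets \<open>k\<close> tend to infinity in the finite version by dominated convergence;
  one of the two limiting factors \<open>1 / (q)_\<infinity>\<close> cancels.\<close>

lemma durfee_infinite:
  "((\<lambda>j. q ^ (j * (j + e)) / (qpoch q q (e + j) * qpoch q q j)) has_sum 1 / qpoch_inf q q) UNIV"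
proof -
  let ?P = "qpoch q q" and ?l = "qpoch_inf q q"
  obtain C where C: "1 \<le> C" "\<And>n. norm (1 / ?P n) \<le> C"
    using qfac_bounds by metis
  define f where "f k j = (if j \<le> k then q ^ (j * (j + e)) / (?P (k - j) * ?P (e + j) * ?P j) else 0)" for k j
  define h where "h j = q ^ (j * (j + e)) / (?P (e + j) * ?P j)" for j
  have bound: "norm (f k j) \<le> C ^ 3 * norm q ^ j" for k j
  proof (cases "j \<le> k")
    case True
    have "norm q ^ (j * (j + e)) \<le> norm q ^ j"
      using norm_q by (intro power_decreasing) auto
    then have "norm (1 / ?P (k - j)) * norm (1 / ?P (e + j)) * norm (1 / ?P j) * norm q ^ (j * (j + e))
       \<le> C * C * C * norm q ^ j"
      using C by (intro mult_mono mult_nonneg_nonneg) auto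
    then show ?thesis
      using True by (simp add: f_def norm_divide norm_mult norm_power power3_eq_cube)
  next
    case False
    then show ?thesis
      using C by (simp add: f_def)
  qed
  have lim: "(\<lambda>k. f k j) \<longlonglongrightarrow> (1 / ?l) * h j" for j
  proof (rule LIMSEQ_offset)
    have "(\<lambda>k. q ^ (j * (j + e)) / (?P k * ?P (e + j) * ?P j)) \<longlonglongrightarrow> q ^ (j * (j + e)) / (?l * ?P (e + j) * ?P j)"
      using norm_q qfac_inf_nz by (intro tendsto_intros qfac_tendsto) (simp add: qfac_nz)
    then show "(\<lambda>k. f (k + j) j) \<longlonglongrightarrow> (1 / ?l) * h j"
      by (simp add: f_def h_def mult.assoc)
  qed
  have g: "(\<lambda>j. C ^ 3 * norm q ^ j) summable_on UNIV"
    using norm_q by (intro summable_on_cmult_right summable_on_power_nat) auto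
  have f_sum: "infsum (f k) UNIV = 1 / (?P k * ?P (k + e))" for k
  proof -
    have "(f k has_sum (\<Sum>j\<le>k. f k j)) UNIV"
      by (rule has_sum_finite_neutralI[where B = "{..k}"]) (auto simp: f_def)
    then show ?thesis
      using durfee_finite[where k = k and e = e] by (simp add: infsumI f_def)
  qed
  have "(\<lambda>k. 1 / (?P k * ?P (k + e))) \<longlonglongrightarrow> infsum (\<lambda>j. (1 / ?l) * h j) UNIV"
    using tendsto_infsum_dominated(1)[OF bound g lim] by (simp only: f_sum)
  moreover have "(\<lambda>k. 1 / (?P k * ?P (k + e))) \<longlonglongrightarrow> 1 / (?l * ?l)"
    using qfac_inf_nz by (intro tendsto_intros qfac_tendsto LIMSEQ_ignore_initial_segment) auto
  ultimately have "infsum (\<lambda>j. (1 / ?l) * h j) UNIV = 1 / (?l * ?l)"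
    using LIMSEQ_unique by blast
  then have "((\<lambda>j. (1 / ?l) * h j) has_sum 1 / (?l * ?l)) UNIV"
    using has_sum_infsum[OF tendsto_infsum_dominated(2)[OF bound g lim]] by simp
  then show ?thesis
    using qfac_inf_nz by (subst (asm) has_sum_cmult_right_iff) (auto simp: h_def[abs_def])
qed

lemma bailey_beta_eq:
  "bailey_beta q N x = (if nat \<bar>x\<bar> \<le> N
      then 1 / (qpoch q q (N - nat \<bar>x\<bar>) * qpoch q q (N + nat \<bar>x\<bar>)) else 0)"
proof -
  have "qbinom q (2 * int N) (int N - x) = qbinom q (2 * int N) (int N - \<bar>x\<bar>)"
    by (cases "0 \<le> x") (simp, subst qbinom_symm, simp)
  moreover have "qbinom q (2 * int N) (int N - \<bar>x\<bar>) = gbin q (2 * N) (N - nat \<bar>x\<bar>)" if "nat \<bar>x\<bar> \<le> N"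
    using that by (subst qbinom_of_nat[symmetric]) (simp add: of_nat_diff)
  moreover have "2 * N - (N - nat \<bar>x\<bar>) = N + nat \<bar>x\<bar>" if "nat \<bar>x\<bar> \<le> N"
    using that by simp
  moreover have "qbinom q (2 * int N) (int N - \<bar>x\<bar>) = 0" if "\<not> nat \<bar>x\<bar> \<le> N"
    using that by (intro qbinom_eq_0) linarith
  ultimately show ?thesis
    using qfac_nz[OF norm_q, of "2 * N"] by (cases "nat \<bar>x\<bar> \<le> N") (simp_all add: bailey_beta_def gbin_def)
qed

text \<open>The Bailey lemma with both free parameters sent to infinity. With
  \<open>d = \<bar>x\<bar>\<close> and \<open>m = d + j\<close> it is \<open>durfee_finite\<close>
  for \<open>k = N - d\<close>, \<open>e = 2 * d\<close>.\<close>

lemma bailey_step: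
  "(\<Sum>m\<le>N. q ^ m\<^sup>2 / qpoch q q (N - m) * bailey_beta q m x) = q ^ nat (x\<^sup>2) * bailey_beta q N x"
proof -
  let ?P = "qpoch q q"
  define d where "d = nat \<bar>x\<bar>"
  have x2: "nat (x\<^sup>2) = d\<^sup>2"
    by (simp add: d_def nat_power_eq[symmetric])
  show ?thesis
  proof (cases "d \<le> N")
    case False
    then have "bailey_beta q m x = 0" if "m \<le> N" for m
      using that by (simp add: bailey_beta_eq d_def[symmetric])
    then show ?thesis by simp
  next
    case True
    have "(\<Sum>m\<le>N. q ^ m\<^sup>2 / ?P (N - m) * bailey_beta q m x)
        = (\<Sum>m\<in>{d..N}. q ^ m\<^sup>2 / ?P (N - m) * (1 / (?P (m - d) * ?P (m + d))))"
      by (rule sum.mono_neutral_cong_right) (auto simp: bailey_beta_eq d_def)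
    also have "\<dots> = (\<Sum>j\<le>N - d. q ^ (d + j)\<^sup>2 / ?P (N - (d + j)) * (1 / (?P (d + j - d) * ?P (d + j + d))))"
      by (rule sum.reindex_bij_witness[of _ "\<lambda>j. d + j" "\<lambda>m. m - d"]) (use True in auto)
    also have "\<dots> = q ^ d\<^sup>2 * (\<Sum>j\<le>N - d. q ^ (j * (j + 2 * d)) / (?P (N - d - j) * ?P (2 * d + j) * ?P j))"
      unfolding sum_distrib_left
    proof (rule sum.cong[OF refl])
      fix j
      have "(d + j)\<^sup>2 = d\<^sup>2 + j * (j + 2 * d)" "d + j - d = j" "d + j + d = 2 * d + j" "N - (d + j) = N - d - j"
        by (simp_all add: power2_eq_square algebra_simps)
      then show "q ^ (d + j)\<^sup>2 / ?P (N - (d + j)) * (1 / (?P (d + j - d) * ?P (d + j + d)))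
         = q ^ d\<^sup>2 * (q ^ (j * (j + 2 * d)) / (?P (N - d - j) * ?P (2 * d + j) * ?P j))"
        by (simp only: power_add) (simp add: mult_ac)
    qed
    also have "\<dots> = q ^ d\<^sup>2 * (1 / (?P (N - d) * ?P (N - d + 2 * d)))"
      by (simp only: durfee_finite)
    also have "\<dots> = q ^ nat (x\<^sup>2) * bailey_beta q N x"
      using True by (simp add: bailey_beta_eq d_def[symmetric] x2 add.commute[of N])
    finally show ?thesis .
  qed
qed

text \<open>The case \<open>N = \<infinity>\<close> of the preceding step, by the same shift and
  \<open>durfee_infinite\<close>.\<close>

lemma bailey_limit:
  "((\<lambda>N. q ^ N\<^sup>2 * bailey_beta q N x) has_sum q ^ nat (x\<^sup>2) / qpoch_inf q q) UNIV"
proof -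
  let ?P = "qpoch q q"
  define d where "d = nat \<bar>x\<bar>"
  have x2: "nat (x\<^sup>2) = d\<^sup>2"
    by (simp add: d_def nat_power_eq[symmetric])
  have "((\<lambda>j. q ^ d\<^sup>2 * (q ^ (j * (j + 2 * d)) / (?P (2 * d + j) * ?P j))) has_sum q ^ d\<^sup>2 * (1 / qpoch_inf q q)) UNIV"
    by (intro has_sum_cmult_right durfee_infinite)
  also have "(\<lambda>j. q ^ d\<^sup>2 * (q ^ (j * (j + 2 * d)) / (?P (2 * d + j) * ?P j))) = (\<lambda>j. q ^ (d + j)\<^sup>2 * bailey_beta q (d + j) x)"
  proof
    fix j
    have b: "bailey_beta q (d + j) x = 1 / (?P (d + j - d) * ?P (d + j + d))"
      by (simp only: bailey_beta_eq d_def[symmetric] le_add1 if_True)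
    have e: "(d + j)\<^sup>2 = d\<^sup>2 + j * (j + 2 * d)" "d + j - d = j" "d + j + d = 2 * d + j"
      by (simp_all add: power2_eq_square algebra_simps)
    show "q ^ d\<^sup>2 * (q ^ (j * (j + 2 * d)) / (?P (2 * d + j) * ?P j)) = q ^ (d + j)\<^sup>2 * bailey_beta q (d + j) x"
      by (simp only: b e power_add) (simp add: mult_ac)
  qed
  finally have "((\<lambda>N. q ^ N\<^sup>2 * bailey_beta q N x) has_sum q ^ d\<^sup>2 * (1 / qpoch_inf q q)) (range ((+) d))"
    by (subst has_sum_reindex) (auto simp: o_def)
  also have "?this \<longleftrightarrow> ((\<lambda>N. q ^ N\<^sup>2 * bailey_beta q N x) has_sum q ^ d\<^sup>2 * (1 / qpoch_inf q q)) UNIV"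
  proof (rule has_sum_cong_neutral)
    fix N assume "N \<in> UNIV - range ((+) d)"
    then have "\<not> d \<le> N"
      using le_Suc_ex by blast
    then show "q ^ N\<^sup>2 * bailey_beta q N x = 0"
      by (simp add: bailey_beta_eq d_def)
  qed auto
  finally show ?thesis
    by (simp add: x2)
qed

end

text \<open>Limit of the finite form. The exponents add up to
  \<open>n^2 \<ge> \<bar>n\<bar>\<close>, which gives a geometric majorant, and the central
  binomials tend to \<open>1 / (ab; ab)_\<infinity>\<close>.\<close>

theorem jacobi_triple_product:
  fixes a b :: complex
  assumes "norm a < 1" "norm b < 1"
  shows "((\<lambda>n::int. a ^ tri (n + 1) * b ^ tri n) has_sum
     qpoch_inf (- a) (a * b) * qpoch_inf (- b) (a * b) * qpoch_inf (a * b) (a * b)) UNIV"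
proof -
  let ?Q = "a * b"
  define c where "c n = a ^ tri (n + 1) * b ^ tri n" for n
  define \<rho> where "\<rho> = max (norm a) (norm b)"
  have \<rho>: "0 \<le> \<rho>" "\<rho> < 1" "norm a \<le> \<rho>" "norm b \<le> \<rho>"
    using assms by (auto simp: \<rho>_def le_max_iff_disj)
  have "norm a * norm b \<le> norm a * 1"
    using assms by (intro mult_left_mono) auto
  then have Q: "norm ?Q < 1"
    using assms by (simp add: norm_mult)
  note P_nz = qfac_inf_nz[OF Q]
  have norm_c: "norm (c n) \<le> \<rho> ^ nat \<bar>n\<bar>" for n
  proof -
    have "nat \<bar>n\<bar> \<le> nat \<bar>n\<bar> * nat \<bar>n\<bar>"
      by (rule le_square)
    also have "\<dots> = nat (int (tri (n + 1) + tri n))"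
      unfolding tri_Suc_add by (simp add: nat_mult_distrib[symmetric])
    finally have le: "nat \<bar>n\<bar> \<le> tri (n + 1) + tri n"
      by (simp only: nat_int)
    have "norm (c n) \<le> \<rho> ^ tri (n + 1) * \<rho> ^ tri n"
      unfolding c_def norm_mult norm_power using \<rho> by (intro mult_mono power_mono) auto
    also have "\<dots> \<le> \<rho> ^ nat \<bar>n\<bar>"
      unfolding power_add[symmetric] using \<rho> le by (intro power_decreasing) auto
    finally show ?thesis .
  qed
  obtain C where C: "1 \<le> C" "\<And>n k. norm (gbin ?Q n k) \<le> C"
    using qfac_bounds[OF Q] by metis
  define f where "f N n = c n * qbinom ?Q (2 * int N) (int N + n)" for N n
  have "norm (qbinom ?Q x y) \<le> C" for x y
  proof (cases "0 \<le> x \<and> 0 \<le> y")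
    case True
    then show ?thesis
      using C by (simp add: qbinom_eq_gbin)
  next
    case False
    then have "qbinom ?Q x y = 0"
      by (auto simp: qbinom_def)
    then show ?thesis
      using C by simp
  qed
  then have bound: "norm (f N n) \<le> \<rho> ^ nat \<bar>n\<bar> * C" for N n
    unfolding f_def norm_mult using norm_c \<rho> by (intro mult_mono) auto
  have g: "(\<lambda>n::int. \<rho> ^ nat \<bar>n\<bar> * C) summable_on UNIV"
    using \<rho> by (intro summable_on_cmult_left summable_on_power_int)
  have lim: "(\<lambda>N. f N n) \<longlonglongrightarrow> c n * (1 / qpoch_inf ?Q ?Q)" for n
  proof -
    let ?d = "nat \<bar>n\<bar>"
    \<comment> \<open>Shifting \<open>N\<close> by \<open>\<bar>n\<bar>\<close> makes both lower
      indices non-negative, so that the binomial is a genuine quotient of factorials.\<close>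
    have "(\<lambda>N. qbinom ?Q (2 * int (N + ?d)) (int (N + ?d) + n)) \<longlonglongrightarrow> 1 / qpoch_inf ?Q ?Q"
    proof -
      have "qbinom ?Q (2 * int (N + ?d)) (int (N + ?d) + n)
         = qpoch ?Q ?Q (2 * (N + ?d)) / (qpoch ?Q ?Q (N + nat (\<bar>n\<bar> + n)) * qpoch ?Q ?Q (N + nat (\<bar>n\<bar> - n)))" for N
      proof -
        have "nat (2 * int (N + ?d)) = 2 * (N + ?d)" "nat (int (N + ?d) + n) = N + nat (\<bar>n\<bar> + n)"
          "nat (2 * int (N + ?d) - (int (N + ?d) + n)) = N + nat (\<bar>n\<bar> - n)"
          "0 \<le> int (N + ?d) + n" "int (N + ?d) + n \<le> 2 * int (N + ?d)"
          by (cases "0 \<le> n"; simp add: nat_add_distrib nat_mult_distrib)+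
        then show ?thesis
          unfolding qbinom_def by simp
      qed
      moreover have "(\<lambda>N. qpoch ?Q ?Q (2 * (N + ?d)) / (qpoch ?Q ?Q (N + nat (\<bar>n\<bar> + n)) * qpoch ?Q ?Q (N + nat (\<bar>n\<bar> - n))))
         \<longlonglongrightarrow> qpoch_inf ?Q ?Q / (qpoch_inf ?Q ?Q * qpoch_inf ?Q ?Q)"
      proof (rule tendsto_divide[OF _ tendsto_mult])
        have "strict_mono (\<lambda>N. 2 * (N + ?d))"
          by (rule strict_monoI) simp
        then show "(\<lambda>N. qpoch ?Q ?Q (2 * (N + ?d))) \<longlonglongrightarrow> qpoch_inf ?Q ?Q"
          using LIMSEQ_subseq_LIMSEQ[OF qfac_tendsto[OF Q]] by (simp add: o_def)
      qed (use P_nz in \<open>simp_all add: LIMSEQ_ignore_initial_segment qfac_tendsto[OF Q]\<close>)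
      ultimately show ?thesis
        using P_nz by simp
    qed
    then have "(\<lambda>N. qbinom ?Q (2 * int N) (int N + n)) \<longlonglongrightarrow> 1 / qpoch_inf ?Q ?Q"
      by (rule LIMSEQ_offset)
    then show ?thesis
      unfolding f_def by (intro tendsto_mult tendsto_const)
  qed
  have f_sum: "infsum (f N) UNIV = qpoch (- a) ?Q N * qpoch (- b) ?Q N" for N
  proof -
    have "(f N has_sum (\<Sum>n=-int N..int N. f N n)) UNIV"
      by (rule has_sum_finite_neutralI[where B = "{-int N..int N}"]) (auto simp: f_def qbinom_eq_0)
    moreover have "(\<Sum>n=-int N..int N. f N n) = qpoch (- a) ?Q N * qpoch (- b) ?Q N"
      using finite_jacobi_triple[OF Q, of N] by (simp add: f_def c_def qpoch_def)
    ultimately show ?thesis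
      by (simp add: infsumI)
  qed
  have "(\<lambda>N. qpoch (- a) ?Q N * qpoch (- b) ?Q N) \<longlonglongrightarrow> infsum (\<lambda>n. c n * (1 / qpoch_inf ?Q ?Q)) UNIV"
    using tendsto_infsum_dominated(1)[OF bound g lim] by (simp only: f_sum)
  moreover have "(\<lambda>N. qpoch (- a) ?Q N * qpoch (- b) ?Q N) \<longlonglongrightarrow> qpoch_inf (- a) ?Q * qpoch_inf (- b) ?Q"
    using assms by (intro tendsto_mult qpoch_tendsto[OF Q]) auto
  ultimately have "infsum (\<lambda>n. c n * (1 / qpoch_inf ?Q ?Q)) UNIV = qpoch_inf (- a) ?Q * qpoch_inf (- b) ?Q"
    using LIMSEQ_unique by blast
  then have "((\<lambda>n. c n * (1 / qpoch_inf ?Q ?Q)) has_sum qpoch_inf (- a) ?Q * qpoch_inf (- b) ?Q) UNIV"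
    using has_sum_infsum[OF tendsto_infsum_dominated(2)[OF bound g lim]] by simp
  then have "((\<lambda>n. c n * (1 / qpoch_inf ?Q ?Q) * qpoch_inf ?Q ?Q) has_sum qpoch_inf (- a) ?Q * qpoch_inf (- b) ?Q * qpoch_inf ?Q ?Q) UNIV"
    by (rule has_sum_cmult_left)
  then show ?thesis
    using P_nz by (simp add: c_def)
qed

section \<open>Summation over the multi-index\<close>

text \<open>Encodes tuples indexed by \<open>X\<close> as functions that vanish elsewhere, in
  accordance with the summation set of the theorem.\<close>

definition supp_on :: "nat set \<Rightarrow> (nat \<Rightarrow> nat) set" where
  "supp_on X = {m. \<forall>i. i \<notin> X \<longrightarrow> m i = 0}"

lemma supp_on_empty: "supp_on {} = {\<lambda>_. 0}"
  by (auto simp: supp_on_def)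

lemma bij_betw_supp_on_insert:
  assumes "j \<notin> X"
  shows "bij_betw (\<lambda>(n, m). m(j := n)) (UNIV \<times> supp_on X) (supp_on (insert j X))"
proof (rule bij_betwI[where g = "\<lambda>m. (m j, m(j := 0))"])
  show "(\<lambda>(n, m). m(j := n)) \<in> UNIV \<times> supp_on X \<rightarrow> supp_on (insert j X)"
    by (auto simp: supp_on_def)
  show "(\<lambda>m. (m j, m(j := 0))) \<in> supp_on (insert j X) \<rightarrow> UNIV \<times> supp_on X"
    by (auto simp: supp_on_def)
qed (use assms in \<open>auto simp: supp_on_def fun_eq_iff\<close>)

lemma has_sum_finite_Times:
  fixes f :: "'a \<times> 'b \<Rightarrow> 'c :: topological_comm_monoid_add"
  assumes "finite C" "\<And>n. n \<in> C \<Longrightarrow> ((\<lambda>m. f (n, m)) has_sum g n) A"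
  shows "(f has_sum (\<Sum>n\<in>C. g n)) (C \<times> A)"
  using assms
proof (induction C rule: finite_induct)
  case (insert n C)
  have "(f has_sum g n) (Pair n ` A)"
    using insert.prems by (subst has_sum_reindex) (auto simp: o_def inj_on_def)
  moreover have "(f has_sum (\<Sum>n\<in>C. g n)) (C \<times> A)"
    using insert by auto
  ultimately have "(f has_sum (g n + (\<Sum>n\<in>C. g n))) (Pair n ` A \<union> C \<times> A)"
    by (rule has_sum_Un_disjoint) (use insert.hyps in auto)
  moreover have "Pair n ` A \<union> C \<times> A = insert n C \<times> A"
    by auto
  ultimately show ?case
    using insert.hyps by simp
qed simp

text \<open>Sums out one coordinate of which only finitely many values contribute.\<close>

lemma has_sum_supp_on_insert:
  fixes f :: "(nat \<Rightarrow> nat) \<Rightarrow> 'c :: {topological_comm_monoid_add, t2_space}"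
  assumes "j \<notin> X" "finite C"
    and "\<And>n. n \<in> C \<Longrightarrow> ((\<lambda>m. f (m(j := n))) has_sum g n) (supp_on X)"
    and "\<And>n m. n \<notin> C \<Longrightarrow> f (m(j := n)) = 0"
  shows "(f has_sum (\<Sum>n\<in>C. g n)) (supp_on (insert j X))"
proof -
  have "((\<lambda>(n, m). f (m(j := n))) has_sum (\<Sum>n\<in>C. g n)) (C \<times> supp_on X)"
    using assms by (intro has_sum_finite_Times) auto
  also have "?this \<longleftrightarrow> ((\<lambda>(n, m). f (m(j := n))) has_sum (\<Sum>n\<in>C. g n)) (UNIV \<times> supp_on X)"
    by (rule has_sum_cong_neutral) (use assms in auto)
  also have "\<dots> \<longleftrightarrow> (f has_sum (\<Sum>n\<in>C. g n)) (supp_on (insert j X))"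
    using has_sum_reindex_bij_betw[OF bij_betw_supp_on_insert[OF assms(1)], of f]
    by (simp add: case_prod_unfold)
  finally show ?thesis .
qed

lemma summable_on_supp_on_power:
  fixes r :: real
  assumes "finite X" "0 \<le> r" "r < 1"
  shows "(\<lambda>m. \<Prod>i\<in>X. r ^ m i) summable_on supp_on X"
  using assms(1)
proof (induction X rule: finite_induct)
  case (insert j X)
  let ?p = "\<lambda>m. \<Prod>i\<in>X. r ^ m i"
  have "(\<lambda>(n, m). r ^ n * ?p m) summable_on UNIV \<times> supp_on X"
  proof (rule summable_on_SigmaI)
    show "((\<lambda>m. case (n, m) of (n, m) \<Rightarrow> r ^ n * ?p m) has_sum r ^ n * infsum ?p (supp_on X)) (supp_on X)" for n
      using insert.IH by (auto intro!: has_sum_cmult_right has_sum_infsum)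
    show "(\<lambda>n. r ^ n * infsum ?p (supp_on X)) summable_on UNIV"
      using assms by (intro summable_on_cmult_left summable_on_power_nat)
  qed (use assms in \<open>auto intro!: mult_nonneg_nonneg prod_nonneg\<close>)
  also have "(\<lambda>(n, m). r ^ n * ?p m) = (\<lambda>x. \<Prod>i\<in>insert j X. r ^ (case x of (n, m) \<Rightarrow> m(j := n)) i)"
  proof
    fix x :: "nat \<times> (nat \<Rightarrow> nat)"
    obtain n m where x: "x = (n, m)" by force
    have "(\<Prod>i\<in>X. r ^ (m(j := n)) i) = ?p m"
      using insert.hyps by (intro prod.cong) auto
    then show "(case x of (n, m) \<Rightarrow> r ^ n * ?p m) = (\<Prod>i\<in>insert j X. r ^ (case x of (n, m) \<Rightarrow> m(j := n)) i)"
      using insert.hyps by (simp add: x)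
  qed
  finally show ?case
    using summable_on_reindex_bij_betw[OF bij_betw_supp_on_insert[OF insert.hyps(2)], of "\<lambda>m. \<Prod>i\<in>insert j X. r ^ m i"]
    by simp
qed (simp add: supp_on_empty)

text \<open>The factors of the summand that belong to indices from \<open>j\<close> on, where
  \<open>K = k - 2\<close> is the last index. At \<open>j = K\<close> only the two coupling factors
  of \<open>m_(K-1)\<close> and \<open>m_K\<close> are left.\<close>

definition chain_term :: "complex \<Rightarrow> nat \<Rightarrow> nat \<Rightarrow> (nat \<Rightarrow> nat) \<Rightarrow> complex" where
  "chain_term q K j m = q ^ ((\<Sum>i=j..<K. (m i)\<^sup>2) + m (K - 1) * m K)
     * (\<Prod>i=j..<K. qbinom q (int (m (i - 1)) + int (m i) - int (m (i + 1))) (2 * int (m i)))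
     * qbinom q (int (m (K - 1))) (int (m K))"

lemma chain_term_step:
  assumes "j < K"
  shows "chain_term q K j m = q ^ (m j)\<^sup>2 * qbinom q (int (m (j - 1)) + int (m j) - int (m (j + 1))) (2 * int (m j))
    * chain_term q K (Suc j) m"
  using assms by (simp add: chain_term_def sum.atLeast_Suc_lessThan prod.atLeast_Suc_lessThan power_add mult_ac)

text \<open>The first remaining binomial has its lower index above its upper one. Hence
  \<open>m_j\<close> is bounded by \<open>m_(j-1)\<close>, and the sums over the tail are
  finite.\<close>

lemma chain_term_eq_0:
  assumes "j \<le> K" "m (j - 1) < m j"
  shows "chain_term q K j m = 0"
proof (cases "j = K")
  case True
  then show ?thesis
    using assms by (simp add: chain_term_def)
next
  case False
  then show ?thesis
    using assms by (subst chain_term_step) (simp_all add: qbinom_eq_0)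
qed

lemma chain_term_cong:
  assumes "j \<le> K" "0 < j" "\<And>i. j - 1 \<le> i \<Longrightarrow> m i = m' i"
  shows "chain_term q K j m = chain_term q K j m'"
proof -
  have "m (K - 1) = m' (K - 1)" "m K = m' K"
    using assms by auto
  moreover have "(\<Sum>i=j..<K. (m i)\<^sup>2) = (\<Sum>i=j..<K. (m' i)\<^sup>2)"
    using assms by (intro sum.cong) auto
  moreover have "(\<Prod>i=j..<K. qbinom q (int (m (i - 1)) + int (m i) - int (m (i + 1))) (2 * int (m i)))
     = (\<Prod>i=j..<K. qbinom q (int (m' (i - 1)) + int (m' i) - int (m' (i + 1))) (2 * int (m' i)))"
    using assms by (intro prod.cong) auto
  ultimately show ?thesis
    by (simp add: chain_term_def)
qed

text \<open>Identifies the recursion of \<open>chain_sum\<close> with the multiple sum over the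
  tail, one coordinate at a time.\<close>

lemma has_sum_chain_term:
  assumes "0 < j"
  shows "((\<lambda>m. chain_term q (j + t) j (m(j - 1 := a, j := b))) has_sum chain_sum q t a b) (supp_on {j<..j + t})"
  using assms
proof (induction t arbitrary: j a b)
  case 0
  then show ?case
    by (simp add: supp_on_empty chain_term_def has_sum_finiteI)
next
  case (Suc t)
  let ?K = "j + Suc t"
  have K: "{j<..?K} = insert (Suc j) {Suc j<..?K}"
    by auto
  have shape: "chain_term q ?K j (m(Suc j := c, j - 1 := a, j := b))
      = q ^ b\<^sup>2 * (qbinom q (int a + int b - int c) (2 * int b) * chain_term q ?K (Suc j) (m(Suc j - 1 := b, Suc j := c)))" for m c
  proof -
    \<comment> \<open>The tail from \<open>Suc j\<close> on looks back only as far as index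
      \<open>j\<close>, so the value at \<open>j - 1\<close> drops out.\<close>
    have "chain_term q ?K (Suc j) (m(Suc j := c, j - 1 := a, j := b)) = chain_term q ?K (Suc j) (m(Suc j - 1 := b, Suc j := c))"
      using Suc.prems by (intro chain_term_cong) auto
    then show ?thesis
      using Suc.prems by (subst chain_term_step) (auto simp: mult_ac)
  qed
  have "((\<lambda>m. chain_term q ?K j (m(j - 1 := a, j := b))) has_sum
     (\<Sum>c\<le>b. q ^ b\<^sup>2 * (qbinom q (int a + int b - int c) (2 * int b) * chain_sum q t b c))) (supp_on {j<..?K})"
    unfolding K
  proof (rule has_sum_supp_on_insert)
    fix c
    have "((\<lambda>m. chain_term q ?K (Suc j) (m(Suc j - 1 := b, Suc j := c))) has_sum chain_sum q t b c) (supp_on {Suc j<..?K})"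
      using Suc.IH[of "Suc j" b c] by (simp only: add_Suc add_Suc_right zero_less_Suc)
    then show "((\<lambda>m. chain_term q ?K j (m(Suc j := c, j - 1 := a, j := b))) has_sum
        q ^ b\<^sup>2 * (qbinom q (int a + int b - int c) (2 * int b) * chain_sum q t b c)) (supp_on {Suc j<..?K})"
      unfolding shape by (intro has_sum_cmult_right)
  next
    fix c m assume "c \<notin> {..b}"
    then have "chain_term q ?K (Suc j) (m(Suc j - 1 := b, Suc j := c)) = 0"
      by (intro chain_term_eq_0) auto
    then show "chain_term q ?K j (m(Suc j := c, j - 1 := a, j := b)) = 0"
      unfolding shape by simp
  qed auto
  then show ?case
    by (simp only: chain_sum.simps sum_distrib_left)
qed

definition full_term :: "complex \<Rightarrow> nat \<Rightarrow> (nat \<Rightarrow> nat) \<Rightarrow> complex" where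
  "full_term q K m = q ^ ((m 1 + m 2)\<^sup>2 + (m 2)\<^sup>2) / (qpoch q q (m 1) * qpoch q q (2 * m 2)) * chain_term q K 3 m"

context
  fixes q :: complex
  assumes norm_q: "norm q < 1"
begin

text \<open>Where the summand can be non-zero, \<open>m_K \<le> m_(K-1)\<close>, hence
  \<open>m_K \<le> m_(K-1) m_K\<close>; every other index is bounded by the squares. The exponent
  thus dominates the sum of all indices, while the other factors are bounded.\<close>

lemma norm_full_term_le:
  assumes "3 \<le> K"
  obtains C where "\<And>m. norm (full_term q K m) \<le> C * (\<Prod>i=1..K. norm q ^ m i)"
proof -
  obtain C where C: "1 \<le> C" "\<And>n. norm (1 / qpoch q q n) \<le> C" "\<And>n k. norm (gbin q n k) \<le> C"
    using qfac_bounds[OF norm_q] by metis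
  have binom: "norm (qbinom q x y) \<le> C" for x y
  proof (cases "0 \<le> x \<and> 0 \<le> y")
    case True
    then show ?thesis
      using C by (simp add: qbinom_eq_gbin)
  next
    case False
    then have "qbinom q x y = 0"
      by (auto simp: qbinom_def)
    then show ?thesis
      using C by simp
  qed
  have "norm (full_term q K m) \<le> (C * C * (C ^ card {3..<K} * C)) * (\<Prod>i=1..K. norm q ^ m i)" for m
  proof (cases "m (K - 1) < m K")
    case True
    then have "full_term q K m = 0"
      by (simp add: full_term_def chain_term_def qbinom_eq_0)
    then show ?thesis
      using C by (simp add: prod_nonneg)
  next
    case False
    define E where "E = (m 1 + m 2)\<^sup>2 + (m 2)\<^sup>2 + ((\<Sum>i=3..<K. (m i)\<^sup>2) + m (K - 1) * m K)"
    define B where "B = (\<Prod>i=3..<K. qbinom q (int (m (i - 1)) + int (m i) - int (m (i + 1))) (2 * int (m i)))"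
    have sq: "x \<le> x\<^sup>2" for x :: nat
      by (simp add: power2_eq_square)
    have "{1..K} = {1, 2, K} \<union> {3..<K}"
      using assms by auto
    then have "(\<Sum>i=1..K. m i) = m 1 + m 2 + (\<Sum>i=3..<K. m i) + m K"
      using assms by (subst \<open>{1..K} = _\<close>, subst sum.union_disjoint) auto
    also have "\<dots> \<le> (m 1 + m 2)\<^sup>2 + (\<Sum>i=3..<K. (m i)\<^sup>2) + m (K - 1) * m K"
    proof (intro add_mono sq sum_mono)
      show "m K \<le> m (K - 1) * m K"
        using False by (cases "m K") auto
    qed
    also have "\<dots> \<le> E"
      by (simp add: E_def)
    finally have "norm q ^ E \<le> norm q ^ (\<Sum>i=1..K. m i)"
      using norm_q by (intro power_decreasing) auto
    then have E: "norm q ^ E \<le> (\<Prod>i=1..K. norm q ^ m i)"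
      by (simp add: power_sum)
    have "norm B \<le> (\<Prod>i=3..<K. C)"
      unfolding B_def prod_norm[symmetric] using binom by (intro prod_mono) auto
    then have B: "norm B \<le> C ^ card {3..<K}"
      by simp
    have "full_term q K m = (1 / qpoch q q (m 1) * (1 / qpoch q q (2 * m 2))
        * (B * qbinom q (int (m (K - 1))) (int (m K)))) * q ^ E"
      by (simp add: full_term_def chain_term_def E_def B_def power_add)
    then have "norm (full_term q K m) = norm (1 / qpoch q q (m 1)) * norm (1 / qpoch q q (2 * m 2))
        * (norm B * norm (qbinom q (int (m (K - 1))) (int (m K)))) * norm q ^ E"
      by (simp only: norm_mult norm_power)
    also have "\<dots> \<le> (C * C * (C ^ card {3..<K} * C)) * (\<Prod>i=1..K. norm q ^ m i)"
      using C(1) by (intro mult_mono E B binom C mult_nonneg_nonneg zero_le_power norm_ge_zero prod_nonneg) auto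
    finally show ?thesis .
  qed
  then show thesis
    by (rule that)
qed

lemma full_term_summable:
  assumes "3 \<le> K"
  shows "full_term q K summable_on supp_on {1..K}"
proof -
  obtain C where C: "\<And>m. norm (full_term q K m) \<le> C * (\<Prod>i=1..K. norm q ^ m i)"
    using norm_full_term_le[OF assms] by blast
  have "(\<lambda>m. C * (\<Prod>i=1..K. norm q ^ m i)) summable_on supp_on {1..K}"
    using norm_q by (intro summable_on_cmult_right summable_on_supp_on_power) auto
  then have "(\<lambda>m. norm (full_term q K m)) summable_on supp_on {1..K}"
    by (rule summable_on_comparison_test) (use C in auto)
  then show ?thesis
    by (rule abs_summable_summable)
qed

lemma full_term_inner_sum:
  shows "((\<lambda>m. full_term q (t + 3) (m(2 := y, 1 := x))) has_sum
     q ^ ((x + y)\<^sup>2 + y\<^sup>2) / (qpoch q q x * qpoch q q (2 * y)) * (\<Sum>c\<le>y. chain_sum q t y c)) (supp_on {3..t + 3})"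
proof -
  let ?w = "q ^ ((x + y)\<^sup>2 + y\<^sup>2) / (qpoch q q x * qpoch q q (2 * y))"
  have set_eq: "{3..t + 3} = insert 3 {3<..3 + t}"
    by auto
  have "chain_term q (t + 3) 3 (m(2 := y, 1 := x)) = chain_term q (t + 3) 3 (m(2 := y))" for m
    by (rule chain_term_cong) auto
  then have shape: "full_term q (t + 3) (m(2 := y, 1 := x)) = ?w * chain_term q (t + 3) 3 (m(2 := y))" for m
    by (simp add: full_term_def)
  have "((\<lambda>m. chain_term q (t + 3) 3 (m(2 := y))) has_sum (\<Sum>c\<le>y. chain_sum q t y c)) (supp_on {3..t + 3})"
    unfolding set_eq
  proof (rule has_sum_supp_on_insert)
    fix c
    have "((\<lambda>m. chain_term q (3 + t) 3 (m(3 - 1 := y, 3 := c))) has_sum chain_sum q t y c) (supp_on {3<..3 + t})"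
      by (rule has_sum_chain_term) simp
    moreover have "m(3 := c, 2 := y) = m(3 - 1 := y, 3 := c)" for m :: "nat \<Rightarrow> nat"
      by (auto simp: fun_eq_iff)
    ultimately show "((\<lambda>m. chain_term q (t + 3) 3 (m(3 := c, 2 := y))) has_sum chain_sum q t y c) (supp_on {3<..3 + t})"
      by (simp add: add.commute[of t])
  next
    fix c m assume "c \<notin> {..y}"
    then show "chain_term q (t + 3) 3 (m(3 := c, 2 := y)) = 0"
      by (intro chain_term_eq_0) auto
  qed auto
  then show ?thesis
    unfolding shape by (rule has_sum_cmult_right)
qed

text \<open>The sum over \<open>m = m_2\<close> for fixed \<open>N = m_1 + m_2\<close>. The factor
  \<open>1 / (q)_(2m)\<close> turns the central binomial into \<open>bailey_beta\<close>, and the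
  first Bailey step follows.\<close>

lemma bailey_beta_sum:
  "(\<Sum>m\<le>N. q ^ m\<^sup>2 / (qpoch q q (N - m) * qpoch q q (2 * m)) * (\<Sum>c\<le>m. chain_sum q t m c))
   = (\<Sum>n=-int N..int N. theta_coeff q (fib_exp (Suc t) + (fib (t + 3))\<^sup>2) n * bailey_beta q N (int (fib (t + 3)) * n))"
proof -
  let ?f = "int (fib (t + 3))" and ?e = "fib_exp (Suc t)"
  have "(\<Sum>m\<le>N. q ^ m\<^sup>2 / (qpoch q q (N - m) * qpoch q q (2 * m)) * (\<Sum>c\<le>m. chain_sum q t m c))
     = (\<Sum>m\<le>N. \<Sum>n=-int N..int N. theta_coeff q ?e n * (q ^ m\<^sup>2 / qpoch q q (N - m) * bailey_beta q m (?f * n)))"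
  proof (rule sum.cong[OF refl])
    fix m assume "m \<in> {..N}"
    then have s: "(\<Sum>c\<le>m. chain_sum q t m c) = (\<Sum>n=-int N..int N. theta_coeff q ?e n * qbinom q (2 * int m) (int m - ?f * n))"
      by (intro sum_chain_sum[OF norm_q]) simp
    show "q ^ m\<^sup>2 / (qpoch q q (N - m) * qpoch q q (2 * m)) * (\<Sum>c\<le>m. chain_sum q t m c)
      = (\<Sum>n=-int N..int N. theta_coeff q ?e n * (q ^ m\<^sup>2 / qpoch q q (N - m) * bailey_beta q m (?f * n)))"
      unfolding s sum_distrib_left by (intro sum.cong refl) (simp add: bailey_beta_def mult_ac)
  qed
  also have "\<dots> = (\<Sum>n=-int N..int N. theta_coeff q ?e n * (\<Sum>m\<le>N. q ^ m\<^sup>2 / qpoch q q (N - m) * bailey_beta q m (?f * n)))"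
    by (subst sum.swap) (simp only: sum_distrib_left)
  also have "\<dots> = (\<Sum>n=-int N..int N. theta_coeff q (?e + (fib (t + 3))\<^sup>2) n * bailey_beta q N (?f * n))"
    by (simp only: bailey_step[OF norm_q] theta_coeff_add mult.assoc)
  finally show ?thesis .
qed

section \<open>The theta series and the exchange of summations\<close>

lemma norm_theta_coeff_le:
  assumes "0 < e"
  shows "norm (theta_coeff q e n) \<le> norm q ^ nat \<bar>n\<bar>"
proof -
  have "nat \<bar>n\<bar> \<le> nat \<bar>n\<bar> * nat \<bar>n\<bar>"
    by (rule le_square)
  also have "\<dots> = nat (n\<^sup>2)"
    by (simp add: nat_mult_distrib[symmetric] power2_eq_square)
  also have "\<dots> \<le> tri n + e * nat (n\<^sup>2)"
    using assms by (simp add: trans_le_add2)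
  finally show ?thesis
    using norm_q by (simp add: theta_coeff_def norm_mult norm_power power_decreasing)
qed

text \<open>Jacobi's triple product with \<open>a = - (q ^ e)\<close> and
  \<open>b = - (q ^ (e + 1))\<close>, so that \<open>a * b = q ^ (2 * e + 1)\<close>; positivity of
  \<open>e\<close> gives \<open>norm a < 1\<close>.\<close>

lemma theta_coeff_has_sum:
  assumes "0 < e"
  shows "(theta_coeff q e has_sum
     qpoch_inf (q ^ e) (q ^ (2 * e + 1)) * qpoch_inf (q ^ (e + 1)) (q ^ (2 * e + 1)) * qpoch_inf (q ^ (2 * e + 1)) (q ^ (2 * e + 1))) UNIV"
proof -
  have "norm (- (q ^ e)) < 1" "norm (- (q ^ (e + 1))) < 1"
    using norm_q assms by (auto simp only: norm_minus_cancel norm_power power_less_one_iff norm_ge_zero)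
  from jacobi_triple_product[OF this]
  have "((\<lambda>n. (- (q ^ e)) ^ tri (n + 1) * (- (q ^ (e + 1))) ^ tri n) has_sum
     qpoch_inf (q ^ e) (q ^ (2 * e + 1)) * qpoch_inf (q ^ (e + 1)) (q ^ (2 * e + 1)) * qpoch_inf (q ^ (2 * e + 1)) (q ^ (2 * e + 1))) UNIV"
    by (simp add: power_add mult_2 mult_2_right mult_ac)
  also have "(\<lambda>n. (- (q ^ e)) ^ tri (n + 1) * (- (q ^ (e + 1))) ^ tri n) = theta_coeff q e"
  proof
    fix n
    have "int (nat (n\<^sup>2)) = 2 * int (tri n) + n"
      using tri_int[of n] by (simp add: algebra_simps power2_eq_square)
    then have "int (e * tri (n + 1) + (e + 1) * tri n) = int (tri n + e * nat (n\<^sup>2))"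
      by (simp only: of_nat_add of_nat_mult tri_Suc) (simp add: algebra_simps)
    then have e: "e * tri (n + 1) + (e + 1) * tri n = tri n + e * nat (n\<^sup>2)"
      by linarith
    have "(- (q ^ e)) ^ tri (n + 1) * (- (q ^ (e + 1))) ^ tri n
       = ((- 1) ^ tri (n + 1) * (- 1) ^ tri n) * q ^ (e * tri (n + 1) + (e + 1) * tri n)"
      unfolding power_minus[of "q ^ e"] power_minus[of "q ^ (e + 1)"] power_mult[symmetric]
      by (simp only: power_add mult_ac)
    then show "(- (q ^ e)) ^ tri (n + 1) * (- (q ^ (e + 1))) ^ tri n = theta_coeff q e n"
      unfolding e minus_one_power_tri by (simp add: theta_coeff_def)
  qed
  finally show ?thesis .
qed

text \<open>Absolute convergence allows summing over the tail first, then over \<open>m_2\<close> at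
  fixed \<open>N = m_1 + m_2\<close>. The sums over \<open>N\<close> and \<open>n\<close> are then
  exchanged, \<open>bailey_limit\<close> evaluates the one over \<open>N\<close>, and the theta
  series remains.\<close>

lemma full_term_has_sum:
  fixes t :: nat
  defines "e \<equiv> fib_exp (Suc t) + 2 * (fib (t + 3))\<^sup>2"
  shows "(full_term q (t + 3) has_sum
     qpoch_inf (q ^ e) (q ^ (2 * e + 1)) * qpoch_inf (q ^ (e + 1)) (q ^ (2 * e + 1)) * qpoch_inf (q ^ (2 * e + 1)) (q ^ (2 * e + 1))
      / qpoch_inf q q) (supp_on {1..t + 3})"
proof -
  let ?P = "qpoch q q"
  define f where "f = fib (t + 3)"
  define d where "d = fib_exp (Suc t) + f\<^sup>2"
  have "0 < f"
    by (simp add: f_def fib_neq_0_nat)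
  have "0 < d"
    using \<open>0 < f\<close> by (simp add: d_def)
  define S where "S = infsum (full_term q (t + 3)) (supp_on {1..t + 3})"
  define g where "g = (\<lambda>(x, y). q ^ ((x + y)\<^sup>2 + y\<^sup>2) / (?P x * ?P (2 * y)) * (\<Sum>c\<le>y. chain_sum q t y c))"
  have S: "(full_term q (t + 3) has_sum S) (supp_on {1..t + 3})"
    unfolding S_def by (intro has_sum_infsum full_term_summable) simp
  have bij1: "bij_betw (\<lambda>(n, m). m(1 := n)) (UNIV \<times> supp_on {2..t + 3}) (supp_on {1..t + 3})"
    using bij_betw_supp_on_insert[of 1 "{2..t + 3}"] by (simp add: atLeastAtMost_insertL numeral_2_eq_2)
  have bij2: "bij_betw (\<lambda>(n, m). m(2 := n)) (UNIV \<times> supp_on {3..t + 3}) (supp_on {2..t + 3})"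
    using bij_betw_supp_on_insert[of 2 "{3..t + 3}"] atLeastAtMost_insertL[of 2 "t + 3"] by (simp add: numeral_3_eq_3)
  have "((\<lambda>(x, m). full_term q (t + 3) (m(1 := x))) has_sum S) (UNIV \<times> supp_on {2..t + 3})"
    using S has_sum_reindex_bij_betw[OF bij1, of "full_term q (t + 3)" S] by (simp add: case_prod_unfold)
  moreover have "bij_betw (map_prod id (\<lambda>(n, m). m(2 := n))) (UNIV \<times> UNIV \<times> supp_on {3..t + 3}) (UNIV \<times> supp_on {2..t + 3})"
    by (intro bij_betw_map_prod bij2 bij_betw_id)
  ultimately have "((\<lambda>(x, y, m). full_term q (t + 3) (m(2 := y, 1 := x))) has_sum S) (UNIV \<times> UNIV \<times> supp_on {3..t + 3})"
    using has_sum_reindex_bij_betw[of "map_prod id (\<lambda>(n, m). m(2 := n))" "UNIV \<times> UNIV \<times> supp_on {3..t + 3}" "UNIV \<times> supp_on {2..t + 3}"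
        "\<lambda>(x, m). full_term q (t + 3) (m(1 := x))" S]
    by (simp add: case_prod_unfold map_prod_def)
  then have "((\<lambda>(p, m). full_term q (t + 3) (m(2 := snd p, 1 := fst p))) has_sum S) ((UNIV \<times> UNIV) \<times> supp_on {3..t + 3})"
    by (rule has_sum_reindex_bij_witness[where i = "\<lambda>((x, y), m). (x, y, m)" and j = "\<lambda>(x, y, m). ((x, y), m)", THEN iffD1, rotated -1]) auto
  then have "(g has_sum S) (UNIV \<times> UNIV)"
  proof (rule has_sum_SigmaD)
    fix p :: "nat \<times> nat"
    show "((\<lambda>m. case (p, m) of (p, m) \<Rightarrow> full_term q (t + 3) (m(2 := snd p, 1 := fst p))) has_sum g p) (supp_on {3..t + 3})"
      using full_term_inner_sum[of t "snd p" "fst p"] by (simp add: g_def case_prod_unfold)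
  qed
  \<comment> \<open>New variables \<open>N = m_1 + m_2\<close> and \<open>y = m_2\<close>; since
    \<open>y \<le> N\<close>, the subtraction is exact.\<close>
  then have "((\<lambda>(N, y). g (N - y, y)) has_sum S) (Sigma UNIV (\<lambda>N. {..N}))"
    by (rule has_sum_reindex_bij_witness[where i = "\<lambda>(N, y). (N - y, y)" and j = "\<lambda>(x, y). (x + y, y)", THEN iffD1, rotated -1]) auto
  then have "((\<lambda>N. \<Sum>y\<le>N. g (N - y, y)) has_sum S) UNIV"
    by (rule has_sum_SigmaD) (auto intro: has_sum_finiteI)
  also have "(\<lambda>N. \<Sum>y\<le>N. g (N - y, y))
      = (\<lambda>N. \<Sum>n=-int N..int N. theta_coeff q d n * (q ^ N\<^sup>2 * bailey_beta q N (int f * n)))"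
  proof
    fix N
    have "(\<Sum>y\<le>N. g (N - y, y)) = q ^ N\<^sup>2 * (\<Sum>m\<le>N. q ^ m\<^sup>2 / (?P (N - m) * ?P (2 * m)) * (\<Sum>c\<le>m. chain_sum q t m c))"
      unfolding sum_distrib_left[of "q ^ N\<^sup>2"] by (intro sum.cong refl) (simp add: g_def power_add)
    also have "\<dots> = (\<Sum>n=-int N..int N. theta_coeff q d n * (q ^ N\<^sup>2 * bailey_beta q N (int f * n)))"
      unfolding bailey_beta_sum sum_distrib_left[of "q ^ N\<^sup>2"] d_def f_def by (simp only: mult_ac)
    finally show "(\<Sum>y\<le>N. g (N - y, y)) = (\<Sum>n=-int N..int N. theta_coeff q d n * (q ^ N\<^sup>2 * bailey_beta q N (int f * n)))" .
  qed
  finally have H: "((\<lambda>N. \<Sum>n=-int N..int N. theta_coeff q d n * (q ^ N\<^sup>2 * bailey_beta q N (int f * n))) has_sum S) UNIV" .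
  define h where "h = (\<lambda>(N, n). theta_coeff q d n * (q ^ N\<^sup>2 * bailey_beta q N (int f * n)))"
  \<comment> \<open>Since \<open>f \<ge> 1\<close>, \<open>bailey_beta\<close> vanishes for
    \<open>\<bar>n\<bar> > N\<close>, so the finite sum is a sum over all integers.\<close>
  have inner: "((\<lambda>n. h (N, n)) has_sum (\<Sum>n=-int N..int N. theta_coeff q d n * (q ^ N\<^sup>2 * bailey_beta q N (int f * n)))) UNIV" for N
  proof (rule has_sum_finite_neutralI[where B = "{-int N..int N}"])
    fix n assume "n \<in> UNIV - {-int N..int N}"
    then have "int N < \<bar>n\<bar>" by auto
    also have "\<bar>n\<bar> \<le> \<bar>int f * n\<bar>"
      using \<open>0 < f\<close> mult_right_mono[of 1 "int f" "\<bar>n\<bar>"] by (simp add: abs_mult)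
    finally have "\<not> nat \<bar>int f * n\<bar> \<le> N"
      by linarith
    then show "h (N, n) = 0"
      by (simp add: h_def bailey_beta_eq[OF norm_q])
  qed (auto simp: h_def)
  \<comment> \<open>Joint summability for the exchange: \<open>q ^ N\<^sup>2\<close> gives decay in
    \<open>N\<close>, the theta coefficient gives decay in \<open>n\<close>, and
    \<open>bailey_beta\<close> is bounded.\<close>
  have "h summable_on UNIV \<times> UNIV"
  proof -
    obtain C where C: "1 \<le> C" "\<And>n. norm (1 / ?P n) \<le> C"
      using qfac_bounds[OF norm_q] by metis
    have beta: "norm (bailey_beta q N x) \<le> C * C" for N x
    proof (cases "nat \<bar>x\<bar> \<le> N")
      case True
      then have "norm (bailey_beta q N x) = norm (1 / ?P (N - nat \<bar>x\<bar>)) * norm (1 / ?P (N + nat \<bar>x\<bar>))"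
        by (simp add: bailey_beta_eq[OF norm_q] norm_divide norm_mult)
      also have "\<dots> \<le> C * C"
        using C by (intro mult_mono) auto
      finally show ?thesis .
    qed (use C in \<open>simp add: bailey_beta_eq[OF norm_q]\<close>)
    let ?b = "\<lambda>(N, n). norm q ^ N * (norm q ^ nat \<bar>n\<bar> * (C * C))"
    have b: "?b summable_on (UNIV :: nat set) \<times> (UNIV :: int set)"
    proof (rule summable_on_SigmaI)
      show "((\<lambda>n::int. case (N, n) of (N, n) \<Rightarrow> norm q ^ N * (norm q ^ nat \<bar>n\<bar> * (C * C))) has_sum
          norm q ^ N * infsum (\<lambda>n::int. norm q ^ nat \<bar>n\<bar> * (C * C)) UNIV) UNIV" for N
        using norm_q by (auto intro!: has_sum_cmult_right has_sum_infsum summable_on_cmult_left summable_on_power_int)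
      show "(\<lambda>N. norm q ^ N * infsum (\<lambda>n::int. norm q ^ nat \<bar>n\<bar> * (C * C)) UNIV) summable_on UNIV"
        using norm_q by (intro summable_on_cmult_left summable_on_power_nat) auto
    qed (use C in auto)
    have "norm (h p) \<le> ?b p" for p
    proof -
      obtain N n where p: "p = (N, n)" by force
      have "norm q ^ N\<^sup>2 \<le> norm q ^ N"
        using norm_q by (intro power_decreasing) (auto simp: power2_eq_square)
      then have "norm (theta_coeff q d n) * (norm q ^ N\<^sup>2 * norm (bailey_beta q N (int f * n)))
         \<le> norm q ^ nat \<bar>n\<bar> * (norm q ^ N * (C * C))"
        using C norm_theta_coeff_le[OF \<open>0 < d\<close>] beta by (intro mult_mono mult_nonneg_nonneg) auto
      then show ?thesis
        by (simp add: p h_def norm_mult norm_power mult_ac)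
    qed
    then have "(\<lambda>p. norm (h p)) summable_on UNIV \<times> UNIV"
      by (intro summable_on_comparison_test[OF b]) auto
    then show ?thesis
      by (rule abs_summable_summable)
  qed
  then have "(h has_sum S) (UNIV \<times> UNIV)"
    by (rule has_sum_SigmaI[OF inner H])
  then have "((\<lambda>(n, N). h (N, n)) has_sum S) (UNIV \<times> UNIV)"
    by (subst (asm) has_sum_swap)
  then have "((\<lambda>n. theta_coeff q d n * (q ^ nat ((int f * n)\<^sup>2) / qpoch_inf q q)) has_sum S) UNIV"
  proof (rule has_sum_SigmaD)
    fix n
    show "((\<lambda>N. case (n, N) of (n, N) \<Rightarrow> h (N, n)) has_sum theta_coeff q d n * (q ^ nat ((int f * n)\<^sup>2) / qpoch_inf q q)) UNIV"
      using has_sum_cmult_right[OF bailey_limit[OF norm_q, of "int f * n"], of "theta_coeff q d n"] by (simp add: h_def)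
  qed
  also have "(\<lambda>n. theta_coeff q d n * (q ^ nat ((int f * n)\<^sup>2) / qpoch_inf q q)) = (\<lambda>n. theta_coeff q e n * (1 / qpoch_inf q q))"
  proof
    fix n
    have "e = d + f\<^sup>2"
      by (simp add: e_def d_def f_def)
    then show "theta_coeff q d n * (q ^ nat ((int f * n)\<^sup>2) / qpoch_inf q q) = theta_coeff q e n * (1 / qpoch_inf q q)"
      using theta_coeff_add[of q d f n] by simp
  qed
  finally have "((\<lambda>n. theta_coeff q e n * (1 / qpoch_inf q q)) has_sum S) UNIV" .
  moreover have "0 < e"
    using \<open>0 < f\<close> by (simp add: e_def f_def)
  ultimately have "S = qpoch_inf (q ^ e) (q ^ (2 * e + 1)) * qpoch_inf (q ^ (e + 1)) (q ^ (2 * e + 1)) * qpoch_inf (q ^ (2 * e + 1)) (q ^ (2 * e + 1))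
      * (1 / qpoch_inf q q)"
    using has_sum_unique has_sum_cmult_left[OF theta_coeff_has_sum] by blast
  with S show ?thesis
    by simp
qed

end

theorem theorem1p7:
  fixes q :: complex and k :: nat
  assumes "norm q < 1" and "k \<ge> 5"
  shows "((\<lambda>m::nat \<Rightarrow> nat.
            q ^ ((m 1 + m 2)\<^sup>2 + (\<Sum>j=2..k-3. (m j)\<^sup>2) + m (k-3) * m (k-2))
            / (qpoch q q (m 1) * qpoch q q (2 * m 2))
            * (\<Prod>j=3..k-3. qbinom q (int (m (j-1)) + int (m j) - int (m (j+1))) (2 * int (m j)))
            * qbinom q (int (m (k-3))) (int (m (k-2))))
         has_sum
           (qpoch_inf (q ^ (fib k * fib (k-2) - 1)) (q ^ (2 * fib k * fib (k-2) - 1))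
            * qpoch_inf (q ^ (fib k * fib (k-2))) (q ^ (2 * fib k * fib (k-2) - 1))
            * qpoch_inf (q ^ (2 * fib k * fib (k-2) - 1)) (q ^ (2 * fib k * fib (k-2) - 1))
            / qpoch_inf q q))
         {m. \<forall>i. i \<notin> {1..k-2} \<longrightarrow> m i = 0}"
proof -
  define t where "t = k - 5"
  have k: "k = t + 5"
    using assms by (simp add: t_def)
  define e where "e = fib_exp (Suc t) + 2 * (fib (t + 3))\<^sup>2"
  have "e + 1 = fib (t + 2) * fib (t + 3) + 2 * (fib (t + 3))\<^sup>2"
    using fib_exp_eq[of "Suc t"] by (simp add: e_def numeral_2_eq_2 numeral_3_eq_3)
  \<comment> \<open>Uses \<open>F_(t+5) = F_(t+2) + 2 F_(t+3)\<close>.\<close>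
  also have "\<dots> = fib (t + 5) * fib (t + 3)"
    by (simp add: numeral_eq_Suc algebra_simps)
  finally have e: "fib k * fib (k - 2) = e + 1"
    by (simp add: k add.commute[of 3])
  then have e': "2 * fib k * fib (k - 2) - 1 = 2 * e + 1"
    by (simp add: mult.assoc)
  have idx: "k - 2 = t + 3" "k - 3 = t + 2"
    by (simp_all add: k)
  have terms: "(\<lambda>m. q ^ ((m 1 + m 2)\<^sup>2 + (\<Sum>j=2..k-3. (m j)\<^sup>2) + m (k-3) * m (k-2))
            / (qpoch q q (m 1) * qpoch q q (2 * m 2))
            * (\<Prod>j=3..k-3. qbinom q (int (m (j-1)) + int (m j) - int (m (j+1))) (2 * int (m j)))
            * qbinom q (int (m (k-3))) (int (m (k-2)))) = full_term q (t + 3)"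
  proof
    fix m :: "nat \<Rightarrow> nat"
    \<comment> \<open>The square of \<open>m_2\<close> is split off because \<open>full_term\<close>
      carries it in its prefactor, outside \<open>chain_term\<close>.\<close>
    have "{2..t + 2} = insert 2 {3..<t + 3}" "{3..t + 2} = {3..<t + 3}"
      by auto
    then show "q ^ ((m 1 + m 2)\<^sup>2 + (\<Sum>j=2..k-3. (m j)\<^sup>2) + m (k-3) * m (k-2))
            / (qpoch q q (m 1) * qpoch q q (2 * m 2))
            * (\<Prod>j=3..k-3. qbinom q (int (m (j-1)) + int (m j) - int (m (j+1))) (2 * int (m j)))
            * qbinom q (int (m (k-3))) (int (m (k-2))) = full_term q (t + 3) m"
      unfolding idx full_term_def chain_term_def by (simp add: power_add)
  qed
  show ?thesis
    unfolding terms e e' add_diff_cancel_right'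
    unfolding idx
    using full_term_has_sum[OF assms(1), of t] by (simp only: supp_on_def e_def)
qed

end
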